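(* Let $(\mathfrak X,+,\mathcal A)$ be a measurable Abelian semigroup with zero element. Let $d,n\in\mathbb N$ and $\ell\in\{0,\dots,n\}$. For $j\in\{1,\dots,n\}$ and $r\in\{1,\dots,d\}$ let $p_j,q_{j,r}\in[0,1]$ with $\sum_{r=1}^d q_{j,r}=1$ and $\lambda_r:=\sum_{j=1}^n p_jq_{j,r}>0$, let $\lambda=\sum_{j=1}^n p_j$, and let $U_r$ be a probability measure on $(\mathfrak X,\mathcal A)$. Set $$Q_j=\sum_{r=1}^d q_{j,r}U_r,\quad Q=\frac1\lambda\sum_{j=1}^n p_jQ_j,\quad R_j=p_j(Q_j-\delta_0),\quad F_j=\delta_0+R_j,$$ $$V_j=F_je^{-R_j}-\delta_0,\quad F=\prod_{j=1}^n F_j.$$ For $k\in\{0,\dots,n\}$ let $$M_k=\sum_{J\subseteq\{1,\dots,n\}:\,|J|=k}\ \prod_{j\in J}V_j,\qquad H_k=M_k\exp(\lambda(Q-\delta_0)),$$ and set $G_\ell=\sum_{k=0}^\ell H_k$. Let $g(z)=2\sum_{m=2}^\infty\frac{m-1}{m!}z^{m-2}$ and $$\alpha_1=\sum_{j=1}^n g(2p_j)\,p_j^2\sum_{r=1}^d q_{j,r}\min\Bigl\{\frac{q_{j,r}}{2^{3/2}\lambda_r},\,2\Bigr\}.$$ If $\alpha_1<\frac1{2^{3/2}}$, then $$\|F-G_\ell\|\le\frac{\sqrt{(2(\ell+1))!}}{(\ell+1)!}\,2^{(\ell+1)/2}\,\frac{\alpha_1^{\ell+1}}{1-2^{3/2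}\alpha_1}.$$
   Context: A measurable Abelian semigroup with zero element $(\mathfrak X,+,\mathcal A)$ is a commutative semigroup $(\mathfrak X,+)$ with identity element $0$ and a $\sigma$-algebra $\mathcal A$ on $\mathfrak X$ such that $(x,y)\mapsto x+y$ is measurable from $(\mathfrak X\times\mathfrak X,\mathcal A\otimes\mathcal A)$ to $(\mathfrak X,\mathcal A)$. $\delta_x$ is the Dirac measure at $x\in\mathfrak X$. Products and powers of finite signed measures on $(\mathfrak X,\mathcal A)$ are convolutions, $VW(A)=\int_{\mathfrak X}V(\{y\in\mathfrak X: x+y\in A\})\,dW(x)$, with empty products and zeroth powers equal to $\delta_0$; $e^V=\exp(V)=\sum_{m=0}^\infty V^m/m!$. $\|V\|=V^+(\mathfrak X)+V^-(\mathfrak X)$ is the total variation norm, where $V=V^+-V^-$ is the Hahn-Jordan decomposition. $|J|$ is the cardinality of a finite set $J$. The function $g$ satisfies $g(z)=\frac{2e^z}{z^2}(e^{-z}-1+z)$ for $z\ne0$ and $g(0)=1$. Convention: $0^0=1$. *)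

theory Defs
  imports "HOL-Probability.Probability"
begin

text \<open>
  The semigroup structure is that of the class \<open>comm_monoid_add\<close>; the measure \<open>M\<close> only
  serves as carrier of the \<open>\<sigma>\<close>-algebra.
\<close>

definition measurable_semigroup :: "'a::comm_monoid_add measure \<Rightarrow> bool" where
  "measurable_semigroup M \<longleftrightarrow>
     space M = UNIV \<and> (\<lambda>(x, y). x + y) \<in> measurable (M \<Otimes>\<^sub>M M) M"

text \<open>
  A finite signed measure on \<open>M\<close> is represented by a set function \<open>V :: 'a set \<Rightarrow> real\<close>.
  Linear combinations are formed pointwise, and only the values on \<open>sets M\<close> are meaningful:
  the operations below and the norm do not depend on the other values.
  The Hahn-Jordan decomposition does not depend on the choice of the Hahn set.
\<close>

definition hahn_set :: "'a measure \<Rightarrow> ('a set \<Rightarrow> real) \<Rightarrow> 'a set \<Rightarrow> bool" where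
  "hahn_set M V P \<longleftrightarrow> P \<in> sets M \<and>
     (\<forall>A\<in>sets M. A \<subseteq> P \<longrightarrow> V A \<ge> 0) \<and> (\<forall>A\<in>sets M. A \<inter> P = {} \<longrightarrow> V A \<le> 0)"

definition jordan_pos :: "'a measure \<Rightarrow> ('a set \<Rightarrow> real) \<Rightarrow> 'a measure" where
  "jordan_pos M V =
     measure_of (space M) (sets M) (\<lambda>A. ennreal (V (A \<inter> (SOME P. hahn_set M V P))))"

definition jordan_neg :: "'a measure \<Rightarrow> ('a set \<Rightarrow> real) \<Rightarrow> 'a measure" where
  "jordan_neg M V =
     measure_of (space M) (sets M) (\<lambda>A. ennreal (- V (A - (SOME P. hahn_set M V P))))"

definition tv_norm :: "'a measure \<Rightarrow> ('a set \<Rightarrow> real) \<Rightarrow> real" where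
  "tv_norm M V = measure (jordan_pos M V) (space M) + measure (jordan_neg M V) (space M)"

definition signed_integral :: "'a measure \<Rightarrow> ('a set \<Rightarrow> real) \<Rightarrow> ('a \<Rightarrow> real) \<Rightarrow> real" where
  "signed_integral M W f = integral\<^sup>L (jordan_pos M W) f - integral\<^sup>L (jordan_neg M W) f"

definition dirac :: "'a measure \<Rightarrow> 'a \<Rightarrow> 'a set \<Rightarrow> real" where
  "dirac M x = measure (return M x)"

definition conv ::
    "'a::comm_monoid_add measure \<Rightarrow> ('a set \<Rightarrow> real) \<Rightarrow> ('a set \<Rightarrow> real) \<Rightarrow> 'a set \<Rightarrow> real" where
  "conv M V W A = signed_integral M W (\<lambda>x. V {y \<in> space M. x + y \<in> A})"

definition conv_power ::
    "'a::comm_monoid_add measure \<Rightarrow> ('a set \<Rightarrow> real) \<Rightarrow> nat \<Rightarrow> 'a set \<Rightarrow> real" where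
  "conv_power M V m = (conv M V ^^ m) (dirac M 0)"

text \<open>
  The factors are multiplied in increasing order of the index; by commutativity of
  convolution the order is immaterial on \<open>sets M\<close>. The index set is meant to be finite.
\<close>

definition conv_prod ::
    "'a::comm_monoid_add measure \<Rightarrow> (nat \<Rightarrow> 'a set \<Rightarrow> real) \<Rightarrow> nat set \<Rightarrow> 'a set \<Rightarrow> real" where
  "conv_prod M V J = foldr (\<lambda>j. conv M (V j)) (sorted_list_of_set J) (dirac M 0)"

text \<open>
  The series converges in total variation; its limit is described by its values on sets.
\<close>

definition conv_exp ::
    "'a::comm_monoid_add measure \<Rightarrow> ('a set \<Rightarrow> real) \<Rightarrow> 'a set \<Rightarrow> real" where
  "conv_exp M V A = (\<Sum>m. conv_power M V m A / fact m)"

text \<open>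
  With the summation index shifted by two, this is
  \<open>2 * (\<Sum>m\<ge>2. (m - 1) / m! * z ^ (m - 2))\<close>.
\<close>

definition g_fun :: "real \<Rightarrow> real" where
  "g_fun z = 2 * (\<Sum>m. real (m + 1) / fact (m + 2) * z ^ m)"

end

theory Submission
  imports Defs
begin

text \<open>
  All signed measures in the theorem lie in the image of a norm-decreasing homomorphism from the
  commutative Banach algebra \<open>\<ell>\<^sup>1\<close> over the free commutative monoid on \<open>d\<close> generators, which maps the
  generator \<open>r\<close> to \<open>U\<^sub>r\<close>; so it suffices to bound the norm there. In this algebra \<open>F - G\<^sub>\<ell>\<close> is the sum
  of the \<open>H\<^sub>k\<close> with \<open>k > \<ell>\<close>, and \<open>V\<^sub>j = - R\<^sub>j\<^sup>2 K(- R\<^sub>j)\<close> with a power series \<open>K\<close> such that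
  \<open>\<parallel>K(- R\<^sub>j)\<parallel> \<le> g(2 p\<^sub>j) / 2\<close>. The exponential factor is the law \<open>W\<close> of independent Poisson variables
  with means \<open>\<lambda>\<^sub>r\<close>. A product of \<open>m\<close> factors \<open>\<Sum>\<^sub>r a\<^sub>r (e\<^sub>r - 1)\<close> with \<open>W\<close> has a multivariate Charlier
  polynomial as density with respect to \<open>W\<close>; by the canonical commutation relations, the
  \<open>L\<^sup>2(W)\<close> norm of that polynomial is at most \<open>sqrt (m!)\<close> times the product of the
  \<open>sqrt (\<Sum>\<^sub>r a\<^sub>r\<^sup>2 / \<lambda>\<^sub>r)\<close>, and Cauchy-Schwarz gives the same bound for the \<open>\<ell>\<^sup>1\<close> norm.
\<close>

section \<open>The convolution algebra of absolutely summable functions\<close>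

text \<open>The \<open>U r\<close> are arbitrary, so on the semigroup itself no explicit density is
  at hand. Over the free commutative monoid, modelled by multisets, the exponential has explicit
  nonnegative weights obeying a Poisson recursion in each coordinate, and an L2 argument becomes
  possible. Origin of the constants: every V_j contributes two increments, so \<open>H k\<close>
  involves polynomials of degree 2k, hence sqrt((2k)!). Summing over the sets J with k elements
  gives a k-th power divided by k!. Writing q^2/lam_r as 2^(3/2) q (q/(2^(3/2) lam_r)) costs 2^(3/2)
  for each index, the bound g/2 returns a factor 1/2, and 2^(k/2) remains. Since sqrt((2k)!)/k! at
  most doubles from k to k+1, the bounds for \<open>H k\<close> decay with ratio 2^(3/2) \<alpha>;
  this explains the hypothesis and the denominator. The obstacle is the minimum with 2. It is taken
  for each r separately, so R_j itself has to be split: the r with lam_r very small against q_{j,r},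
  where the L2 bound is too weak, are estimated by the plain norm. This makes the factors mixed, and
  the constants of the two kinds of factors must be made comparable.\<close>

typedef 'k l1 = "{f :: 'k \<Rightarrow> real. f summable_on UNIV}"
  morphisms coeff Abs_l1
  by (rule exI[of _ "\<lambda>_. 0"]) simp

setup_lifting type_definition_l1

lemma coeff_summable [simp, intro]: "coeff f summable_on A"
  using coeff[of f] summable_on_subset[of "coeff f" UNIV A] by simp

text \<open>Summability along the net of finite subsets is unconditional, hence absolute for real
  functions; so the type is the full l1 space although its definition mentions no absolute
  value.\<close>

lemma abs_coeff_summable [simp, intro]: "(\<lambda>x. \<bar>coeff f x\<bar>) summable_on A"
  using summable_on_iff_abs_summable_on_real[THEN iffD1, OF coeff_summable[of f A]] by simp

lemma summable_on_real_bound: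
  fixes f :: "'b \<Rightarrow> real"
  assumes "g summable_on A" "\<And>x. x \<in> A \<Longrightarrow> \<bar>f x\<bar> \<le> g x"
  shows "f summable_on A"
  by (rule abs_summable_summable, rule Infinite_Sum.abs_summable_on_comparison_test'[of g])
     (simp_all add: assms)

lemma summable_on_abs:
  fixes f :: "'b \<Rightarrow> real"
  assumes "f summable_on A"
  shows "(\<lambda>x. \<bar>f x\<bar>) summable_on A"
  using summable_on_iff_abs_summable_on_real[THEN iffD1, OF assms] by simp

lemma summable_on_diff:
  fixes f g :: "'b \<Rightarrow> real"
  assumes "f summable_on A" "g summable_on A"
  shows "(\<lambda>x. f x - g x) summable_on A"
  using summable_on_add[OF assms(1), of "\<lambda>x. - g x"] assms(2) by (simp add: summable_on_uminus)

lemma l1_eqI: "(\<And>x. coeff f x = coeff g x) \<Longrightarrow> f = g"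
  by (metis coeff_inject ext)

instantiation l1 :: (type) real_vector
begin
lift_definition zero_l1 :: "'a l1" is "\<lambda>_. 0" by simp
lift_definition plus_l1 :: "'a l1 \<Rightarrow> 'a l1 \<Rightarrow> 'a l1" is "\<lambda>f g x. f x + g x"
  by (simp add: summable_on_add)
lift_definition uminus_l1 :: "'a l1 \<Rightarrow> 'a l1" is "\<lambda>f x. - f x"
  by (simp add: summable_on_uminus)
lift_definition minus_l1 :: "'a l1 \<Rightarrow> 'a l1 \<Rightarrow> 'a l1" is "\<lambda>f g x. f x - g x"
  by (rule summable_on_diff)
lift_definition scaleR_l1 :: "real \<Rightarrow> 'a l1 \<Rightarrow> 'a l1" is "\<lambda>c f x. c * f x"
  by (simp add: summable_on_cmult_right)
instance
  by standard (transfer; auto simp: algebra_simps)+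
end

lemmas coeff_simps [simp] =
  zero_l1.rep_eq plus_l1.rep_eq uminus_l1.rep_eq minus_l1.rep_eq scaleR_l1.rep_eq

instantiation l1 :: (type) real_normed_vector
begin
definition norm_l1 :: "'a l1 \<Rightarrow> real" where "norm_l1 f = (\<Sum>\<^sub>\<infinity>x. \<bar>coeff f x\<bar>)"
definition dist_l1 :: "'a l1 \<Rightarrow> 'a l1 \<Rightarrow> real" where "dist_l1 f g = norm (f - g)"
definition sgn_l1 :: "'a l1 \<Rightarrow> 'a l1" where "sgn_l1 f = f /\<^sub>R norm f"
definition uniformity_l1 :: "('a l1 \<times> 'a l1) filter"
  where "uniformity_l1 = (INF e\<in>{0<..}. principal {(x, y). dist x y < e})"
definition open_l1 :: "'a l1 set \<Rightarrow> bool"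
  where "open_l1 U \<longleftrightarrow> (\<forall>x\<in>U. \<forall>\<^sub>F (x', y) in uniformity. x' = x \<longrightarrow> y \<in> U)"
instance
proof
  fix f g :: "'a l1" and c :: real
  show "norm f = 0 \<longleftrightarrow> f = 0"
  proof
    assume "norm f = 0"
    then have "\<bar>coeff f x\<bar> = 0" for x
      by (intro nonneg_infsum_le_0D[of "\<lambda>x. \<bar>coeff f x\<bar>" UNIV x]) (simp_all add: norm_l1_def)
    then show "f = 0" by (intro l1_eqI) simp
  qed (simp add: norm_l1_def)
  have "norm (f + g) \<le> (\<Sum>\<^sub>\<infinity>x. \<bar>coeff f x\<bar> + \<bar>coeff g x\<bar>)"
    unfolding norm_l1_def using abs_coeff_summable[of "f+g"]
    by (intro infsum_mono) (auto simp: summable_on_add)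
  then show "norm (f + g) \<le> norm f + norm g"
    by (simp add: norm_l1_def infsum_add)
  show "norm (c *\<^sub>R f) = \<bar>c\<bar> * norm f"
    by (simp add: norm_l1_def abs_mult infsum_cmult_right)
qed (simp_all add: dist_l1_def sgn_l1_def uniformity_l1_def open_l1_def)
end

lemma abs_coeff_le_norm: "\<bar>coeff f x\<bar> \<le> norm f"
  using finite_sum_le_infsum[of "\<lambda>x. \<bar>coeff f x\<bar>" UNIV "{x}"] by (simp add: norm_l1_def)

lemma sum_abs_coeff_le_norm: "finite S \<Longrightarrow> (\<Sum>x\<in>S. \<bar>coeff f x\<bar>) \<le> norm f"
  using finite_sum_le_infsum[of "\<lambda>x. \<bar>coeff f x\<bar>" UNIV S] by (simp add: norm_l1_def)

lemma bounded_linear_coeff: "bounded_linear (\<lambda>f. coeff f x)"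
  by (rule bounded_linear_intro[where K=1]) (simp_all add: abs_coeff_le_norm)

text \<open>The candidate limit is taken coefficient by coefficient. The Cauchy estimate passes to
  the limit on finite index sets, uniformly in the set; this gives first the summability of the
  limit and then convergence in norm.\<close>

instance l1 :: (type) banach
proof
  fix X :: "nat \<Rightarrow> 'a l1"
  assume X: "Cauchy X"
  have "Cauchy (\<lambda>n. coeff (X n) x)" for x
    by (rule bounded_linear.Cauchy[OF bounded_linear_coeff X])
  then have "\<exists>l. (\<lambda>n. coeff (X n) x) \<longlonglongrightarrow> l" for x
    using Cauchy_convergent_iff convergent_def by blast
  then obtain L where L: "\<And>x. (\<lambda>n. coeff (X n) x) \<longlonglongrightarrow> L x"
    by metis
  have tail: "\<exists>N. \<forall>n\<ge>N. \<forall>S. finite S \<longrightarrow> (\<Sum>x\<in>S. \<bar>coeff (X n) x - L x\<bar>) \<le> e" if "e > 0" for e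
  proof -
    obtain N where N: "\<And>m n. m \<ge> N \<Longrightarrow> n \<ge> N \<Longrightarrow> norm (X m - X n) < e"
      using X \<open>e > 0\<close> unfolding Cauchy_iff by metis
    show ?thesis
    proof (intro exI[of _ N] allI impI)
      fix n and S :: "'a set" assume n: "N \<le> n" and S: "finite S"
      have lim: "(\<lambda>m. \<Sum>x\<in>S. \<bar>coeff (X n) x - coeff (X m) x\<bar>) \<longlonglongrightarrow> (\<Sum>x\<in>S. \<bar>coeff (X n) x - L x\<bar>)"
        by (intro tendsto_intros L)
      have "(\<Sum>x\<in>S. \<bar>coeff (X n) x - coeff (X m) x\<bar>) \<le> e" if "m \<ge> N" for m
        using sum_abs_coeff_le_norm[OF S, of "X n - X m"] N[OF n that] by simp
      then show "(\<Sum>x\<in>S. \<bar>coeff (X n) x - L x\<bar>) \<le> e"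
        by (intro LIMSEQ_le_const2[OF lim]) blast
    qed
  qed
  have diff: "(\<lambda>x. coeff (X n) x - L x) summable_on UNIV"
    if "\<And>S. finite S \<Longrightarrow> (\<Sum>x\<in>S. \<bar>coeff (X n) x - L x\<bar>) \<le> e" for n e
    by (rule abs_summable_summable, rule nonneg_bdd_above_summable_on) (auto intro!: bdd_aboveI2[of _ _ e] that)
  obtain N where N: "\<And>S. finite S \<Longrightarrow> (\<Sum>x\<in>S. \<bar>coeff (X N) x - L x\<bar>) \<le> 1"
    using tail[of 1] by auto
  have Ls: "L summable_on UNIV"
    using summable_on_diff[OF coeff_summable diff[OF N], of "X N"]
    by (simp only: diff_diff_eq2 add_diff_cancel_left')
  define Y where "Y = Abs_l1 L"
  have Y: "coeff Y = L" using Ls by (simp add: Y_def Abs_l1_inverse)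
  have "X \<longlonglongrightarrow> Y"
  proof (rule LIMSEQ_I)
    fix r :: real assume "r > 0"
    then obtain N where N: "\<And>n S. n \<ge> N \<Longrightarrow> finite S \<Longrightarrow> (\<Sum>x\<in>S. \<bar>coeff (X n) x - L x\<bar>) \<le> r/2"
      using tail[of "r/2"] by auto
    have "norm (X n - Y) \<le> r/2" if "n \<ge> N" for n
      unfolding norm_l1_def using N[OF that] abs_coeff_summable[of "X n - Y"]
      by (intro infsum_le_finite_sums) (auto simp: Y)
    then show "\<exists>N. \<forall>n\<ge>N. norm (X n - Y) < r"
      using \<open>r > 0\<close> by (intro exI[of _ N]) force
  qed
  then show "convergent X" by (auto simp: convergent_def)
qed

section \<open>Duality between summable and bounded functions\<close>

text \<open>It serves twice: the algebra laws are proved by testing against bounded functions, and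
  the map to signed measures is the pairing with
  \<open>\<lambda>k. measure (mpower k) A\<close>.\<close>

definition pairing :: "'k l1 \<Rightarrow> ('k \<Rightarrow> real) \<Rightarrow> real" where
  "pairing f \<phi> = (\<Sum>\<^sub>\<infinity>x. coeff f x * \<phi> x)"

lemma pairing_summable:
  assumes "\<And>x. \<bar>\<phi> x\<bar> \<le> B"
  shows "(\<lambda>x. coeff f x * \<phi> x) summable_on A"
proof (rule summable_on_real_bound)
  show "(\<lambda>x. \<bar>coeff f x\<bar> * B) summable_on A"
    by (intro summable_on_cmult_left) simp
qed (simp add: abs_mult mult_left_mono assms)

lemma pairing_add: "(\<And>x. \<bar>\<phi> x\<bar> \<le> B) \<Longrightarrow> pairing (f + g) \<phi> = pairing f \<phi> + pairing g \<phi>"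
  unfolding pairing_def by (subst infsum_add[symmetric]) (auto simp: ring_distribs intro: pairing_summable)

lemma pairing_scaleR: "pairing (c *\<^sub>R f) \<phi> = c * pairing f \<phi>"
  unfolding pairing_def by (simp add: infsum_cmult_right' mult.assoc)

lemma pairing_abs_le:
  assumes "\<And>x. \<bar>\<phi> x\<bar> \<le> B"
  shows "\<bar>pairing f \<phi>\<bar> \<le> norm f * B"
proof -
  have "norm (\<Sum>\<^sub>\<infinity>x. coeff f x * \<phi> x) \<le> (\<Sum>\<^sub>\<infinity>x. \<bar>coeff f x\<bar> * B)"
    by (rule norm_infsum_le[OF has_sum_infsum[OF pairing_summable[OF assms]] has_sum_infsum])
       (auto simp: abs_mult assms intro!: mult_left_mono summable_on_cmult_left)
  then show ?thesis by (simp add: pairing_def norm_l1_def infsum_cmult_left)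
qed

lemma bounded_linear_pairing:
  assumes "\<And>x. \<bar>\<phi> x\<bar> \<le> B"
  shows "bounded_linear (\<lambda>f. pairing f \<phi>)"
  by (rule bounded_linear_intro[where K=B])
     (simp_all add: pairing_add[OF assms] pairing_scaleR pairing_abs_le[OF assms])

lemma pairing_single: "pairing f (\<lambda>y. of_bool (y = x)) = coeff f x"
proof -
  have "pairing f (\<lambda>y. of_bool (y = x)) = (\<Sum>\<^sub>\<infinity>y\<in>{x}. coeff f y)"
    unfolding pairing_def by (rule infsum_cong_neutral) auto
  then show ?thesis by simp
qed

lemma l1_eqI_pairing:
  assumes "\<And>\<phi>. (\<And>x. \<bar>\<phi> x\<bar> \<le> 1) \<Longrightarrow> pairing f \<phi> = pairing g \<phi>"
  shows "f = g"
  by (rule l1_eqI) (simp add: assms flip: pairing_single)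

lift_definition single :: "'k \<Rightarrow> 'k l1" is "\<lambda>x y. of_bool (y = x)"
proof -
  fix x :: 'k
  have "(\<lambda>y. of_bool (y = x) :: real) summable_on {x}" by simp
  then show "(\<lambda>y. of_bool (y = x) :: real) summable_on UNIV"
    by (subst summable_on_cong_neutral[where T="{x}"]) auto
qed

lemma coeff_single: "coeff (single x) y = of_bool (y = x)"
  by transfer simp

lemma pairing_single_left: "pairing (single x) \<phi> = \<phi> x"
proof -
  have "pairing (single x) \<phi> = (\<Sum>\<^sub>\<infinity>y\<in>{x}. \<phi> y)"
    unfolding pairing_def by (rule infsum_cong_neutral) (auto simp: coeff_single)
  then show ?thesis by simp
qed

section \<open>The convolution product and its algebra laws\<close>

lemma product_abs_summable:
  fixes f g :: "_ \<Rightarrow> real"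
  assumes "f summable_on UNIV" "g summable_on UNIV"
  shows "(\<lambda>(y, z). f y * g z) summable_on UNIV \<times> UNIV"
proof -
  have f: "(\<lambda>y. \<bar>f y\<bar>) summable_on UNIV" and g: "(\<lambda>y. \<bar>g y\<bar>) summable_on UNIV"
    using assms by (auto intro: summable_on_abs)
  have "(\<lambda>w. norm (case w of (y, z) \<Rightarrow> f y * g z)) summable_on UNIV \<times> UNIV"
    unfolding Infinite_Sum.abs_summable_on_Sigma_iff
    by (auto simp: abs_mult infsum_cmult_right' intro!: summable_on_cmult_right summable_on_cmult_left f g)
  then show ?thesis by (rule abs_summable_summable)
qed

text \<open>An absolutely summable double series is regrouped by the value of y + z. In a general
  monoid the fibres can be infinite, so the regrouped family is indexed by a dependent sum.\<close>

lemma convolution_family: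
  fixes f g :: "'k::comm_monoid_add \<Rightarrow> real"
  assumes "f summable_on UNIV" "g summable_on UNIV" and \<phi>: "\<And>x. \<bar>\<phi> x\<bar> \<le> B"
  shows "(\<lambda>(x, y, z). f y * g z * \<phi> x) summable_on Sigma UNIV (\<lambda>x. {(y, z). y + z = x})" (is ?thesis1)
    and "(\<Sum>\<^sub>\<infinity>(x, y, z)\<in>Sigma UNIV (\<lambda>x. {(y, z). y + z = x}). f y * g z * \<phi> x) =
      (\<Sum>\<^sub>\<infinity>y. \<Sum>\<^sub>\<infinity>z. f y * g z * \<phi> (y + z))" (is ?thesis2)
proof -
  have bij: "bij_betw (\<lambda>(y, z). (y + z, y, z)) (UNIV \<times> UNIV) (Sigma UNIV (\<lambda>x. {(y :: 'k, z). y + z = x}))"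
    by (rule bij_betwI[where g=snd]) auto
  have "(\<lambda>w. \<bar>case w of (y, z) \<Rightarrow> f y * g z\<bar> * B) summable_on UNIV \<times> UNIV"
    by (intro summable_on_cmult_left summable_on_abs product_abs_summable assms)
  then have s: "(\<lambda>(y, z). f y * g z * \<phi> (y + z)) summable_on UNIV \<times> UNIV"
    by (rule summable_on_real_bound) (auto simp: abs_mult intro!: mult_left_mono \<phi>)
  show ?thesis1
    using s by (subst summable_on_reindex_bij_betw[OF bij, symmetric]) (simp add: case_prod_unfold)
  show ?thesis2
    by (subst infsum_reindex_bij_betw[OF bij, symmetric], subst infsum_Sigma'_banach)
       (rule s, auto intro!: infsum_cong)
qed

instantiation l1 :: (comm_monoid_add) times
begin
lift_definition times_l1 :: "'a l1 \<Rightarrow> 'a l1 \<Rightarrow> 'a l1" is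
  "\<lambda>f g x. \<Sum>\<^sub>\<infinity>(y, z)\<in>{(y, z). y + z = x}. f y * g z"
proof -
  fix f g :: "'a \<Rightarrow> real"
  assume "f summable_on UNIV" "g summable_on UNIV"
  from convolution_family(1)[OF this, of "\<lambda>_. 1" 1]
  show "(\<lambda>x. \<Sum>\<^sub>\<infinity>(y, z)\<in>{(y, z). y + z = x}. f y * g z) summable_on UNIV"
    by (intro summable_on_Sigma_banach) (simp add: case_prod_unfold)
qed
instance ..
end

lemma pairing_times:
  assumes "\<And>x. \<bar>\<phi> x\<bar> \<le> B"
  shows "pairing (f * g) \<phi> = pairing f (\<lambda>y. pairing g (\<lambda>z. \<phi> (y + z)))"
proof -
  have "pairing (f * g) \<phi> =
      (\<Sum>\<^sub>\<infinity>x. \<Sum>\<^sub>\<infinity>w\<in>{(y, z). y + z = x}. (case w of (y, z) \<Rightarrow> coeff f y * coeff g z * \<phi> x))"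
    unfolding pairing_def times_l1.rep_eq by (simp add: infsum_cmult_left'[symmetric] case_prod_unfold)
  also have "\<dots> = (\<Sum>\<^sub>\<infinity>y. \<Sum>\<^sub>\<infinity>z. coeff f y * coeff g z * \<phi> (y + z))"
    using convolution_family[OF coeff_summable coeff_summable assms, of f g]
    by (subst infsum_Sigma'_banach) (simp_all add: case_prod_unfold)
  also have "\<dots> = pairing f (\<lambda>y. pairing g (\<lambda>z. \<phi> (y + z)))"
    by (simp add: pairing_def infsum_cmult_right'[symmetric] mult.assoc)
  finally show ?thesis .
qed

lemma pairing_swap:
  assumes "\<And>y z. \<bar>\<psi> y z\<bar> \<le> B"
  shows "pairing f (\<lambda>y. pairing g (\<lambda>z. \<psi> y z)) = pairing g (\<lambda>z. pairing f (\<lambda>y. \<psi> y z))"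
proof -
  have "(\<lambda>w. \<bar>case w of (y, z) \<Rightarrow> coeff f y * coeff g z\<bar> * B) summable_on UNIV \<times> UNIV"
    by (intro summable_on_cmult_left summable_on_abs product_abs_summable coeff_summable)
  then have "(\<lambda>(y, z). coeff f y * coeff g z * \<psi> y z) summable_on UNIV \<times> UNIV"
    by (rule summable_on_real_bound) (auto simp: abs_mult intro!: mult_left_mono assms)
  from infsum_swap_banach[OF this]
  have "(\<Sum>\<^sub>\<infinity>y. \<Sum>\<^sub>\<infinity>z. coeff f y * (coeff g z * \<psi> y z)) = (\<Sum>\<^sub>\<infinity>z. \<Sum>\<^sub>\<infinity>y. coeff g z * (coeff f y * \<psi> y z))"
    by (simp add: mult_ac)
  then show ?thesis
    by (simp add: pairing_def infsum_cmult_right')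
qed

instantiation l1 :: (comm_monoid_add) "{real_normed_algebra_1, comm_ring_1}"
begin
definition one_l1 :: "'a l1" where "one_l1 = single 0"
instance
proof
  fix f g h :: "'a l1" and c :: real
  \<comment> \<open>The inner pairing, as a function of y, is again a bounded test function; this
    lets \<open>pairing_times\<close> be applied twice.\<close>
  have bound: "\<bar>pairing g (\<lambda>z. \<phi> (y + z))\<bar> \<le> norm g" if "\<And>x. \<bar>\<phi> x\<bar> \<le> 1" for \<phi> :: "'a \<Rightarrow> real" and g y
    using pairing_abs_le[of "\<lambda>z. \<phi> (y + z)" 1 g] that by simp
  show comm: "f * g = g * f" for f g :: "'a l1"
  proof (rule l1_eqI_pairing)
    fix \<phi> :: "'a \<Rightarrow> real" assume \<phi>: "\<bar>\<phi> x\<bar> \<le> 1" for x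
    show "pairing (f * g) \<phi> = pairing (g * f) \<phi>"
      unfolding pairing_times[of \<phi>, OF \<phi>] by (subst pairing_swap[of _ 1]) (simp_all add: \<phi> add.commute)
  qed
  show "f * g * h = f * (g * h)"
    by (rule l1_eqI_pairing) (simp add: pairing_times[where B=1] pairing_times[where B="norm h"] bound add.assoc)
  show distrib: "(f + g) * h = f * h + g * h" for f g h :: "'a l1"
    by (rule l1_eqI_pairing)
       (simp add: pairing_times[where B=1] pairing_add[where B=1] pairing_add[where B="norm h"] bound)
  show "f * (g + h) = f * g + f * h"
    using distrib[of g h f] by (simp add: comm)
  show scale: "(c *\<^sub>R f) * g = c *\<^sub>R (f * g)" for f g :: "'a l1"
    by (rule l1_eqI_pairing) (simp add: pairing_times[where B=1] pairing_scaleR)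
  show "f * (c *\<^sub>R g) = c *\<^sub>R (f * g)"
    using scale[of g f] by (simp add: comm)
  show one: "1 * f = f" for f :: "'a l1"
    by (rule l1_eqI_pairing) (simp add: pairing_times[where B=1] one_l1_def pairing_single_left)
  show "f * 1 = f"
    using one[of f] by (simp add: comm)
  show "(0 :: 'a l1) \<noteq> 1"
    by (metis coeff_single coeff_simps(1) one_l1_def of_bool_eq_1_iff zero_neq_one)
  have "norm (single 0 :: 'a l1) = pairing (single (0 :: 'a)) (\<lambda>_. 1)"
    by (simp add: norm_l1_def pairing_def coeff_single)
  then show "norm (1 :: 'a l1) = 1"
    by (simp add: one_l1_def pairing_single_left)
  show "norm (f * g) \<le> norm f * norm g"
  proof -
    \<comment> \<open>The sign pattern of the product is a test function that attains its norm, so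
      submultiplicativity follows from two duality bounds.\<close>
    define \<phi> where "\<phi> x = sgn (coeff (f * g) x)" for x
    have \<phi>: "\<bar>\<phi> x\<bar> \<le> 1" for x by (simp add: \<phi>_def sgn_if)
    have "norm (f * g) = pairing (f * g) \<phi>"
      unfolding norm_l1_def pairing_def by (intro infsum_cong) (simp add: \<phi>_def abs_sgn mult.commute)
    also have "\<dots> = pairing f (\<lambda>y. pairing g (\<lambda>z. \<phi> (y + z)))"
      by (rule pairing_times[OF \<phi>])
    also have "\<dots> \<le> norm f * norm g"
      using pairing_abs_le[of "\<lambda>y. pairing g (\<lambda>z. \<phi> (y + z))" "norm g" f] bound[of \<phi> g] \<phi> by fastforce
    finally show ?thesis .
  qed
qed
end

lemma norm_single [simp]: "norm (single x :: 'k l1) = 1"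
proof -
  have "norm (single x :: 'k l1) = pairing (single (x :: 'k)) (\<lambda>_. 1)"
    by (simp add: norm_l1_def pairing_def coeff_single)
  then show ?thesis by (simp add: pairing_single_left)
qed

section \<open>Increments of Poisson weights\<close>

abbreviation gen :: "'i \<Rightarrow> 'i multiset l1" where "gen r \<equiv> single {#r#}"

text \<open>Multiplication by a generator, read on coefficients. The case distinction is essential
  because multiset subtraction truncates.\<close>

definition shift_down :: "'i \<Rightarrow> ('i multiset \<Rightarrow> real) \<Rightarrow> 'i multiset \<Rightarrow> real" where
  "shift_down r \<phi> x = (if r \<in># x then \<phi> (x - {#r#}) else 0)"

lemma coeff_gen_times: "coeff (gen r * f) x = shift_down r (coeff f) x"
proof -
  have "coeff (gen r * f) x = pairing f (\<lambda>z. of_bool ({#r#} + z = x))"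
    by (subst pairing_single[symmetric], subst pairing_times[where B=1]) (auto simp: pairing_single_left)
  also have "\<dots> = shift_down r (coeff f) x"
  proof (cases "r \<in># x")
    case True
    then have "({#r#} + z = x) = (z = x - {#r#})" for z by auto
    with True show ?thesis by (simp add: shift_down_def pairing_single)
  next
    case False
    then have "({#r#} + z = x) = False" for z by auto
    with False show ?thesis by (simp add: shift_down_def pairing_def)
  qed
  finally show ?thesis .
qed

lemma shift_down_commute: "shift_down s (shift_down r \<phi>) x = shift_down r (shift_down s \<phi>) x"
  by (cases "r = s") (auto simp: shift_down_def in_diff_count add_mset_commute)

lemma shift_down_cmult: "shift_down s (\<lambda>x. c * \<phi> x) x = c * shift_down s \<phi> x"
  by (simp add: shift_down_def)

lemma shift_down_sum: "shift_down s (\<lambda>x. \<Sum>i\<in>A. \<phi> i x) x = (\<Sum>i\<in>A. shift_down s (\<phi> i) x)"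
  by (simp add: shift_down_def)

text \<open>The commutator of the number operator \<open>count x r\<close> with the shift in
  direction s is the shift itself if r = s and zero otherwise.\<close>

lemma count_shift_down:
  fixes \<phi> :: "'i multiset \<Rightarrow> real"
  shows "count x r * shift_down s \<phi> x = shift_down s (\<lambda>y. count y r * \<phi> y) x + of_bool (r = s) * shift_down s \<phi> x"
proof (cases "s \<in># x")
  case True
  then obtain y where "x = add_mset s y" by (metis mset_add)
  then show ?thesis by (auto simp: shift_down_def algebra_simps)
qed (simp add: shift_down_def)

lemma power_le_fact_exp:
  fixes x :: real
  assumes "0 \<le> x"
  shows "x ^ k \<le> fact k * exp x"
proof -
  have "(\<Sum>n\<in>{k}. x ^ n /\<^sub>R fact n) \<le> exp x"
    unfolding exp_def using assms by (intro sum_le_suminf summable_exp_generic) auto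
  then show ?thesis by (simp add: field_simps)
qed

lemma coeff_sum: "coeff (sum f A) x = (\<Sum>a\<in>A. coeff (f a) x)"
  by (induction A rule: infinite_finite_induct) auto

section \<open>Poisson weights and their recursion\<close>

locale poisson_weights =
  fixes D :: "'i set" and lam :: "'i \<Rightarrow> real"
  assumes finite_D [simp, intro]: "finite D" and lam_pos: "\<And>r. r \<in> D \<Longrightarrow> 0 < lam r"
begin

definition intensity :: "'i multiset l1" where
  "intensity = (\<Sum>r\<in>D. lam r *\<^sub>R gen r)"

definition weight :: "'i multiset l1" where
  "weight = exp (\<Sum>r\<in>D. lam r *\<^sub>R (gen r - 1))"

definition increment :: "('i \<Rightarrow> real) \<Rightarrow> 'i multiset l1" where
  "increment a = (\<Sum>r\<in>D. a r *\<^sub>R (gen r - 1))"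

lemma coeff_intensity_times: "coeff (intensity * f) x = (\<Sum>s\<in>D. lam s * shift_down s (coeff f) x)"
  by (simp add: intensity_def sum_distrib_right coeff_sum coeff_gen_times)

lemma coeff_increment_times:
  "coeff (increment a * f) x = (\<Sum>s\<in>D. a s * (shift_down s (coeff f) x - coeff f x))"
  by (simp add: increment_def sum_distrib_right coeff_sum coeff_gen_times left_diff_distrib)

text \<open>Multiplying coefficients by \<open>count x r\<close> is the Euler operator e_r d/de_r,
  and this is its value on the m-th power of the linear form with coefficients \<open>lam\<close>.
  The truncated exponent at m = 0 is harmless because the factor m vanishes.\<close>

lemma count_coeff_intensity_power:
  "count x r * coeff (intensity ^ m) x =
    real m * (of_bool (r \<in> D) * lam r * shift_down r (coeff (intensity ^ (m - 1))) x)"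
proof (induction m arbitrary: x)
  case 0
  then show ?case by (cases "x = {#}") (simp_all add: one_l1_def coeff_single)
next
  case (Suc m)
  have "count x r * coeff (intensity ^ Suc m) x = (\<Sum>s\<in>D. lam s * (count x r * shift_down s (coeff (intensity ^ m)) x))"
    by (simp add: coeff_intensity_times sum_distrib_left mult_ac)
  also have "\<dots> = (\<Sum>s\<in>D. lam s * shift_down s (\<lambda>y. count y r * coeff (intensity ^ m) y) x)
      + (\<Sum>s\<in>D. lam s * of_bool (r = s) * shift_down s (coeff (intensity ^ m)) x)"
    unfolding sum.distrib[symmetric]
    by (intro sum.cong refl) (subst count_shift_down, simp add: algebra_simps)
  also have "(\<Sum>s\<in>D. lam s * of_bool (r = s) * shift_down s (coeff (intensity ^ m)) x)
      = of_bool (r \<in> D) * lam r * shift_down r (coeff (intensity ^ m)) x"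
    by (simp add: of_bool_def if_distrib[of "\<lambda>c. _ * c"] if_distrib[of "\<lambda>c. c * _"] sum.delta' cong: if_cong)
  also have "(\<Sum>s\<in>D. lam s * shift_down s (\<lambda>y. count y r * coeff (intensity ^ m) y) x)
      = (\<Sum>s\<in>D. lam s * shift_down s (\<lambda>y. (real m * (of_bool (r \<in> D) * lam r))
          * shift_down r (coeff (intensity ^ (m - 1))) y) x)"
    by (simp only: Suc mult.assoc)
  also have "\<dots> = real m * (of_bool (r \<in> D) * lam r) *
      shift_down r (\<lambda>y. \<Sum>s\<in>D. lam s * shift_down s (coeff (intensity ^ (m - 1))) y) x"
    unfolding shift_down_cmult shift_down_sum
    by (simp add: sum_distrib_left mult_ac shift_down_commute[of r])
  also have "\<dots> = real m * (of_bool (r \<in> D) * lam r) * shift_down r (coeff (intensity ^ m)) x"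
    by (cases m) (simp_all add: coeff_intensity_times[abs_def])
  finally show ?case by (simp add: algebra_simps)
qed

lemma coeff_exp_sums: "(\<lambda>n. coeff (f ^ n) x / fact n) sums coeff (exp f) x"
  using bounded_linear.sums[OF bounded_linear_coeff summable_sums[OF summable_exp_generic[of f]], of x]
  by (simp add: exp_def divide_inverse_commute)

lemma count_coeff_exp_intensity:
  "count x r * coeff (exp intensity) x = of_bool (r \<in> D) * lam r * shift_down r (coeff (exp intensity)) x"
proof -
  have sd: "(\<lambda>n. shift_down r (coeff (intensity ^ n)) x / fact n) sums shift_down r (coeff (exp intensity)) x"
    using coeff_exp_sums by (auto simp: shift_down_def)
  have eq: "count x r * (coeff (intensity ^ Suc n) x / fact (Suc n)) =
      of_bool (r \<in> D) * lam r * (shift_down r (coeff (intensity ^ n)) x / fact n)" for n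
  proof -
    have "count x r * (coeff (intensity ^ Suc n) x / fact (Suc n)) =
        (count x r * coeff (intensity ^ Suc n) x) / fact (Suc n)" by simp
    also have "\<dots> = of_bool (r \<in> D) * lam r * (shift_down r (coeff (intensity ^ n)) x / fact n)"
      unfolding count_coeff_intensity_power by simp
    finally show ?thesis .
  qed
  have zero: "count x r * (coeff (intensity ^ 0) x / fact 0) = 0"
    using count_coeff_intensity_power[of x r 0] by simp
  have "(\<lambda>n. count x r * (coeff (intensity ^ n) x / fact n)) sums (count x r * coeff (exp intensity) x)"
    by (intro sums_mult coeff_exp_sums)
  \<comment> \<open>The constant term is annihilated by \<open>count x r\<close>, so the series
    starts at n = 1; after the index shift, (n + 1) / (n + 1)! becomes 1 / n!.\<close>
  then have "(\<lambda>n. count x r * (coeff (intensity ^ Suc n) x / fact (Suc n))) sums (count x r * coeff (exp intensity) x)"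
    by (subst sums_Suc_iff[of "\<lambda>n. count x r * (coeff (intensity ^ n) x / fact n)"]) (simp only: zero add_0_right)
  moreover have "(\<lambda>n. count x r * (coeff (intensity ^ Suc n) x / fact (Suc n))) sums
      (of_bool (r \<in> D) * lam r * shift_down r (coeff (exp intensity)) x)"
    unfolding eq by (intro sums_mult sd)
  ultimately show ?thesis by (rule sums_unique2)
qed

lemma coeff_intensity_power_nonneg: "0 \<le> coeff (intensity ^ m) x"
proof (induction m arbitrary: x)
  case (Suc m)
  then show ?case
    by (auto simp: coeff_intensity_times shift_down_def intro!: sum_nonneg mult_nonneg_nonneg less_imp_le[OF lam_pos])
qed (simp add: one_l1_def coeff_single)

text \<open>Homogeneity of the powers; it turns scaling of \<open>intensity\<close> into the factor
  c ^ size x in \<open>exponential_moment\<close>.\<close>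

lemma coeff_intensity_power_degree: "size x \<noteq> m \<Longrightarrow> coeff (intensity ^ m) x = 0"
proof (induction m arbitrary: x)
  case (Suc m)
  have "shift_down s (coeff (intensity ^ m)) x = 0" for s
    using Suc by (auto simp: shift_down_def size_Diff_singleton dest!: multi_member_split)
  then show ?case by (simp add: coeff_intensity_times)
qed (simp add: one_l1_def coeff_single)

lemma weight_eq: "weight = exp (- sum lam D) *\<^sub>R exp intensity"
proof -
  have "(\<Sum>r\<in>D. lam r *\<^sub>R (gen r - 1)) = intensity + of_real (- sum lam D)"
    by (simp add: intensity_def scaleR_diff_right sum_subtractf of_real_def scaleR_sum_left)
  then have "weight = exp intensity * exp (of_real (- sum lam D))"
    unfolding weight_def by (simp only: exp_add_commuting mult.commute)
  also have "\<dots> = exp (- sum lam D) *\<^sub>R exp intensity"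
    by (simp only: exp_of_real) (simp add: of_real_def)
  finally show ?thesis .
qed

lemma weight_nonneg: "0 \<le> coeff weight x"
  unfolding weight_eq using sums_le[OF _ sums_zero coeff_exp_sums, of intensity x]
  by (simp add: coeff_intensity_power_nonneg)

text \<open>The recursion k P(k) = lam P(k - 1) of the Poisson law, one coordinate at a time. It
  takes the place of the product formula for the weights and is the source of Mecke's identity
  below.\<close>

lemma count_coeff_weight:
  "count x r * coeff weight x = of_bool (r \<in> D) * lam r * shift_down r (coeff weight) x"
  using count_coeff_exp_intensity[of x r] by (simp add: weight_eq shift_down_cmult mult.left_commute)

text \<open>The normalisation exp(- sum lam) compensates the triangle inequality for the exponential
  series; an upper bound on the mass suffices for the final estimate.\<close>

lemma norm_weight_le: "norm weight \<le> 1"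
proof -
  have "norm intensity \<le> sum lam D"
    unfolding intensity_def by (rule order_trans[OF norm_sum]) (simp add: less_imp_le[OF lam_pos])
  then have "norm (exp intensity) \<le> exp (sum lam D)"
    using norm_exp[of intensity] by (meson exp_le_cancel_iff order_trans)
  then have "exp (- sum lam D) * norm (exp intensity) \<le> exp (- sum lam D) * exp (sum lam D)"
    by (rule mult_left_mono) simp
  then show ?thesis by (simp add: weight_eq flip: exp_add)
qed

text \<open>Up to a constant this family is the coefficient family of
  \<open>exp (c *\<^sub>R intensity)\<close>, an element of the algebra, so it is summable.\<close>

lemma exponential_moment: "(\<lambda>x. coeff weight x * c ^ size x) summable_on UNIV"
proof -
  have eq: "coeff ((c *\<^sub>R intensity) ^ n) x / fact n = c ^ size x * (coeff (intensity ^ n) x / fact n)" for n x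
    using coeff_intensity_power_degree[of x n] by auto
  have "coeff (exp (c *\<^sub>R intensity)) x = c ^ size x * coeff (exp intensity) x" for x
    by (rule sums_unique2[OF coeff_exp_sums]) (unfold eq, intro sums_mult coeff_exp_sums)
  then have "(\<lambda>x. coeff weight x * c ^ size x) = coeff (exp (- sum lam D) *\<^sub>R exp (c *\<^sub>R intensity))"
    by (auto simp: weight_eq)
  then show ?thesis by (simp only: coeff_summable)
qed

section \<open>Functions of polynomial growth and their expectations\<close>

text \<open>A class of integrands closed under products, counts and shifts, so that sums against
  \<open>weight\<close> can be split freely. The summand 1 keeps the base at least 1, which lets
  exponents be increased.\<close>

definition poly_growth :: "('i multiset \<Rightarrow> real) \<Rightarrow> bool" where
  "poly_growth \<phi> \<longleftrightarrow> (\<exists>C k. 0 \<le> C \<and> (\<forall>x. \<bar>\<phi> x\<bar> \<le> C * real (size x + 1) ^ k))"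

lemma poly_growthI:
  assumes "\<And>x. \<bar>\<phi> x\<bar> \<le> C * real (size x + 1) ^ k"
  shows "poly_growth \<phi>"
proof -
  have "0 \<le> \<bar>\<phi> {#}\<bar>" by simp
  also have "\<dots> \<le> C" using assms[of "{#}"] by simp
  finally show ?thesis unfolding poly_growth_def using assms by blast
qed

lemma poly_growth_const: "poly_growth (\<lambda>_. c)"
  by (rule poly_growthI[of _ "\<bar>c\<bar>" 0]) simp

lemma poly_growth_add:
  assumes "poly_growth \<phi>" "poly_growth \<psi>"
  shows "poly_growth (\<lambda>x. \<phi> x + \<psi> x)"
proof -
  obtain B k C m where
    B: "0 \<le> B" "\<And>x. \<bar>\<phi> x\<bar> \<le> B * real (size x + 1) ^ k" and
    C: "0 \<le> C" "\<And>x. \<bar>\<psi> x\<bar> \<le> C * real (size x + 1) ^ m"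
    using assms unfolding poly_growth_def by metis
  have "\<bar>\<phi> x + \<psi> x\<bar> \<le> (B + C) * real (size x + 1) ^ (k + m)" for x
  proof -
    have "B * real (size x + 1) ^ k \<le> B * real (size x + 1) ^ (k + m)"
      "C * real (size x + 1) ^ m \<le> C * real (size x + 1) ^ (k + m)"
      using B(1) C(1) by (auto intro!: mult_left_mono power_increasing)
    with B(2)[of x] C(2)[of x] show ?thesis by (simp add: distrib_right)
  qed
  then show ?thesis by (rule poly_growthI)
qed

lemma poly_growth_mult:
  assumes "poly_growth \<phi>" "poly_growth \<psi>"
  shows "poly_growth (\<lambda>x. \<phi> x * \<psi> x)"
proof -
  obtain B k C m where
    B: "0 \<le> B" "\<And>x. \<bar>\<phi> x\<bar> \<le> B * real (size x + 1) ^ k" and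
    C: "0 \<le> C" "\<And>x. \<bar>\<psi> x\<bar> \<le> C * real (size x + 1) ^ m"
    using assms unfolding poly_growth_def by metis
  have "\<bar>\<phi> x * \<psi> x\<bar> \<le> (B * C) * real (size x + 1) ^ (k + m)" for x
  proof -
    have "\<bar>\<phi> x\<bar> * \<bar>\<psi> x\<bar> \<le> (B * real (size x + 1) ^ k) * (C * real (size x + 1) ^ m)"
      by (rule mult_mono[OF B(2) C(2)]) (use B(1) in auto)
    then show ?thesis by (simp only: abs_mult power_add mult_ac)
  qed
  then show ?thesis by (rule poly_growthI)
qed

lemma poly_growth_diff: "poly_growth \<phi> \<Longrightarrow> poly_growth \<psi> \<Longrightarrow> poly_growth (\<lambda>x. \<phi> x - \<psi> x)"
  using poly_growth_add[of \<phi> "\<lambda>x. - 1 * \<psi> x"] poly_growth_mult[OF poly_growth_const[of "- 1"], of \<psi>] by simp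

lemma poly_growth_sum: "(\<And>i. i \<in> A \<Longrightarrow> poly_growth (\<phi> i)) \<Longrightarrow> poly_growth (\<lambda>x. \<Sum>i\<in>A. \<phi> i x)"
  by (induction A rule: infinite_finite_induct) (auto intro: poly_growth_const poly_growth_add)

lemma poly_growth_count: "poly_growth (\<lambda>x. count x r)"
  by (rule poly_growthI[of _ 1 1]) (use count_le_size[of _ r, THEN le_SucI] in \<open>simp flip: of_nat_Suc\<close>)

lemma poly_growth_add_mset:
  assumes "poly_growth \<phi>"
  shows "poly_growth (\<lambda>x. \<phi> (add_mset r x))"
proof -
  obtain C k where C: "0 \<le> C" "\<And>x. \<bar>\<phi> x\<bar> \<le> C * real (size x + 1) ^ k"
    using assms unfolding poly_growth_def by metis
  have "\<bar>\<phi> (add_mset r x)\<bar> \<le> (C * 2 ^ k) * real (size x + 1) ^ k" for x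
  proof -
    have "real (size (add_mset r x) + 1) ^ k \<le> (2 * real (size x + 1)) ^ k"
      by (intro power_mono) auto
    then have "C * real (size (add_mset r x) + 1) ^ k \<le> C * (2 * real (size x + 1)) ^ k"
      using C(1) by (rule mult_left_mono)
    with C(2)[of "add_mset r x"] show ?thesis by (simp only: power_mult_distrib mult.assoc)
  qed
  then show ?thesis by (rule poly_growthI)
qed

lemma poly_growth_remove:
  assumes "poly_growth \<phi>"
  shows "poly_growth (\<lambda>x. \<phi> (x - {#r#}))"
proof -
  obtain C k where C: "0 \<le> C" "\<And>x. \<bar>\<phi> x\<bar> \<le> C * real (size x + 1) ^ k"
    using assms unfolding poly_growth_def by metis
  have "\<bar>\<phi> (x - {#r#})\<bar> \<le> C * real (size x + 1) ^ k" for x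
  proof -
    have "real (size (x - {#r#}) + 1) ^ k \<le> real (size x + 1) ^ k"
      by (intro power_mono) (auto intro: size_mset_mono)
    then have "C * real (size (x - {#r#}) + 1) ^ k \<le> C * real (size x + 1) ^ k"
      using C(1) by (rule mult_left_mono)
    with C(2)[of "x - {#r#}"] show ?thesis by simp
  qed
  then show ?thesis by (rule poly_growthI)
qed

lemmas poly_growth_intros = poly_growth_const poly_growth_add poly_growth_mult poly_growth_diff
  poly_growth_sum poly_growth_count poly_growth_add_mset poly_growth_remove

text \<open>A power of size + 1 is dominated by an exponential, so the exponential moment with c = e
  is a summable majorant.\<close>

lemma weight_poly_growth_summable:
  assumes "poly_growth \<phi>"
  shows "(\<lambda>x. coeff weight x * \<phi> x) summable_on A"
proof -
  obtain C k where C: "0 \<le> C" "\<And>x. \<bar>\<phi> x\<bar> \<le> C * real (size x + 1) ^ k"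
    using assms unfolding poly_growth_def by metis
  have bound: "\<bar>coeff weight x * \<phi> x\<bar> \<le> coeff weight x * exp 1 ^ size x * (C * fact k * exp 1)" for x
  proof -
    have "real (size x + 1) ^ k \<le> fact k * exp (real (size x + 1))"
      by (rule power_le_fact_exp) simp
    also have "\<dots> = exp 1 ^ size x * (fact k * exp 1)"
      by (simp add: exp_add exp_of_nat_mult[of "size x" 1, simplified] mult_ac)
    finally have "C * real (size x + 1) ^ k \<le> C * (exp 1 ^ size x * (fact k * exp 1))"
      using C(1) by (rule mult_left_mono)
    with C(2)[of x] have "\<bar>\<phi> x\<bar> \<le> C * (exp 1 ^ size x * (fact k * exp 1))" by simp
    then have "coeff weight x * \<bar>\<phi> x\<bar> \<le> coeff weight x * (C * (exp 1 ^ size x * (fact k * exp 1)))"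
      by (rule mult_left_mono) (rule weight_nonneg)
    then show ?thesis by (simp add: abs_mult weight_nonneg mult_ac)
  qed
  have "(\<lambda>x. coeff weight x * \<phi> x) summable_on UNIV"
    by (rule summable_on_real_bound[OF summable_on_cmult_left[OF exponential_moment[of "exp 1"]] bound])
  then show ?thesis using summable_on_subset by blast
qed

definition expect :: "('i multiset \<Rightarrow> real) \<Rightarrow> real" where
  "expect \<phi> = (\<Sum>\<^sub>\<infinity>x. coeff weight x * \<phi> x)"

lemma expect_add: "poly_growth \<phi> \<Longrightarrow> poly_growth \<psi> \<Longrightarrow> expect (\<lambda>x. \<phi> x + \<psi> x) = expect \<phi> + expect \<psi>"
  unfolding expect_def
  by (subst infsum_add[symmetric]) (auto simp: weight_poly_growth_summable distrib_left)

lemma expect_cmult: "expect (\<lambda>x. c * \<phi> x) = c * expect \<phi>"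
  unfolding expect_def by (subst infsum_cmult_right'[symmetric]) (simp add: mult_ac)

lemma expect_diff: "poly_growth \<phi> \<Longrightarrow> poly_growth \<psi> \<Longrightarrow> expect (\<lambda>x. \<phi> x - \<psi> x) = expect \<phi> - expect \<psi>"
  using expect_add[of \<phi> "\<lambda>x. - 1 * \<psi> x"] poly_growth_mult[OF poly_growth_const[of "- 1"], of \<psi>]
    expect_cmult[of "- 1" \<psi>] by simp

lemma expect_sum:
  "(\<And>i. i \<in> A \<Longrightarrow> poly_growth (\<phi> i)) \<Longrightarrow> expect (\<lambda>x. \<Sum>i\<in>A. \<phi> i x) = (\<Sum>i\<in>A. expect (\<phi> i))"
proof (induction A rule: infinite_finite_induct)
  case (insert a A)
  then show ?case by (simp add: expect_add poly_growth_sum)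
qed (simp_all add: expect_def)

lemma expect_mono: "poly_growth \<phi> \<Longrightarrow> poly_growth \<psi> \<Longrightarrow> (\<And>x. \<phi> x \<le> \<psi> x) \<Longrightarrow> expect \<phi> \<le> expect \<psi>"
  unfolding expect_def
  by (intro infsum_mono weight_poly_growth_summable mult_left_mono weight_nonneg) auto

section \<open>Mecke's identity and the commutation relations\<close>

text \<open>The Poisson recursion moves the factor \<open>count x r\<close> into a shift of the
  weight; the shifted weight lives on multisets containing r, which are reindexed by removing one
  r.\<close>

lemma mecke:
  fixes \<phi> :: "'i multiset \<Rightarrow> real"
  assumes "r \<in> D"
  shows "expect (\<lambda>x. count x r * \<phi> (x - {#r#})) = lam r * expect \<phi>"
proof -
  have "expect (\<lambda>x. count x r * \<phi> (x - {#r#})) = (\<Sum>\<^sub>\<infinity>x. lam r * (shift_down r (coeff weight) x * \<phi> (x - {#r#})))"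
    unfolding expect_def
    using assms count_coeff_weight[of _ r] by (intro infsum_cong) (simp add: mult_ac)
  also have "\<dots> = lam r * (\<Sum>\<^sub>\<infinity>x. shift_down r (coeff weight) x * \<phi> (x - {#r#}))"
    by (rule infsum_cmult_right')
  also have "(\<Sum>\<^sub>\<infinity>x. shift_down r (coeff weight) x * \<phi> (x - {#r#})) =
      (\<Sum>\<^sub>\<infinity>x\<in>range (add_mset r). shift_down r (coeff weight) x * \<phi> (x - {#r#}))"
    by (rule infsum_cong_neutral) (auto simp: shift_down_def dest!: multi_member_split)
  also have "\<dots> = expect \<phi>"
    by (subst infsum_reindex) (auto simp: expect_def shift_down_def o_def inj_def)
  finally show ?thesis .
qed

text \<open>
  \<open>create a\<close> is multiplication by \<open>increment a\<close>, read on densities with respect to \<open>weight\<close>;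
  \<open>annihilate a\<close> is its adjoint.
\<close>

definition annihilate :: "('i \<Rightarrow> real) \<Rightarrow> ('i multiset \<Rightarrow> real) \<Rightarrow> 'i multiset \<Rightarrow> real" where
  "annihilate a \<phi> x = (\<Sum>r\<in>D. a r * (\<phi> (add_mset r x) - \<phi> x))"

definition create :: "('i \<Rightarrow> real) \<Rightarrow> ('i multiset \<Rightarrow> real) \<Rightarrow> 'i multiset \<Rightarrow> real" where
  "create a \<phi> x = (\<Sum>r\<in>D. a r * (count x r / lam r * \<phi> (x - {#r#}) - \<phi> x))"

text \<open>The covariance of the linear functions sum_r a_r (N_r / lam_r - 1) under independent
  Poisson N_r with means lam_r; it equals
  \<open>annihilate a (create b (\<lambda>_. 1))\<close>.\<close>

definition ip :: "('i \<Rightarrow> real) \<Rightarrow> ('i \<Rightarrow> real) \<Rightarrow> real" where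
  "ip a b = (\<Sum>r\<in>D. a r * b r / lam r)"

lemma poly_growth_create: "poly_growth \<phi> \<Longrightarrow> poly_growth (create a \<phi>)"
  unfolding create_def[abs_def] divide_inverse by (intro poly_growth_intros)

lemma expect_create_mult:
  assumes \<phi>: "poly_growth \<phi>" and \<psi>: "poly_growth \<psi>"
  shows "expect (\<lambda>x. create a \<phi> x * \<psi> x) = expect (\<lambda>x. \<phi> x * annihilate a \<psi> x)"
proof -
  have eq: "expect (\<lambda>x. count x r / lam r * \<phi> (x - {#r#}) * \<psi> x) = expect (\<lambda>x. \<phi> x * \<psi> (add_mset r x))"
    if "r \<in> D" for r
  proof -
    have "expect (\<lambda>x. count x r / lam r * \<phi> (x - {#r#}) * \<psi> x) =
        expect (\<lambda>x. inverse (lam r) * (count x r * (\<phi> (x - {#r#}) * \<psi> (add_mset r (x - {#r#})))))"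
      \<comment> \<open>If r does not occur in x, both sides vanish through the count; otherwise
        removing and adding r gives back x.\<close>
      unfolding expect_def by (intro infsum_cong) (auto simp: divide_inverse mult_ac not_in_iff)
    also have "\<dots> = expect (\<lambda>x. \<phi> x * \<psi> (add_mset r x))"
      using mecke[OF that, of "\<lambda>x. \<phi> x * \<psi> (add_mset r x)"] lam_pos[OF that]
      by (simp only: expect_cmult) simp
    finally show ?thesis .
  qed
  have "expect (\<lambda>x. create a \<phi> x * \<psi> x) =
      expect (\<lambda>x. \<Sum>r\<in>D. a r * (count x r / lam r * \<phi> (x - {#r#}) * \<psi> x - \<phi> x * \<psi> x))"
    unfolding create_def sum_distrib_right by (simp only: left_diff_distrib right_diff_distrib mult.assoc)
  also have "\<dots> = (\<Sum>r\<in>D. a r * (expect (\<lambda>x. count x r / lam r * \<phi> (x - {#r#}) * \<psi> x) - expect (\<lambda>x. \<phi> x * \<psi> x)))"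
    unfolding divide_inverse
    by (subst expect_sum, (intro poly_growth_intros \<phi> \<psi>)[1], subst expect_cmult, subst expect_diff)
       (intro poly_growth_intros \<phi> \<psi> refl)+
  also have "\<dots> = (\<Sum>r\<in>D. a r * (expect (\<lambda>x. \<phi> x * \<psi> (add_mset r x)) - expect (\<lambda>x. \<phi> x * \<psi> x)))"
    using eq by simp
  also have "\<dots> = expect (\<lambda>x. \<Sum>r\<in>D. a r * (\<phi> x * \<psi> (add_mset r x) - \<phi> x * \<psi> x))"
    by (subst expect_sum, (intro poly_growth_intros \<phi> \<psi>)[1], subst expect_cmult, subst expect_diff)
       (intro poly_growth_intros \<phi> \<psi> refl)+
  also have "\<dots> = expect (\<lambda>x. \<phi> x * annihilate a \<psi> x)"
    by (simp add: annihilate_def sum_distrib_left right_diff_distrib mult_ac)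
  finally show ?thesis .
qed

text \<open>The canonical commutation relation [annihilate a, create b] = ip a b. The scalar arises
  because adding a point of kind r raises \<open>count x r\<close> by one.\<close>

lemma annihilate_create:
  "annihilate a (create b \<phi>) x = ip a b * \<phi> x + create b (annihilate a \<phi>) x"
proof -
  \<comment> \<open>For r not in x the subtraction truncates on the right, but there the count is
    zero, so the identity survives.\<close>
  have step: "count (add_mset s x) r / lam r * \<phi> (add_mset s x - {#r#}) =
      count x r / lam r * \<phi> (add_mset s (x - {#r#})) + of_bool (r = s) * (\<phi> x / lam s)" for r s
    by (cases "r \<in># x") (auto simp: not_in_iff add_divide_distrib algebra_simps)
  have "create b \<phi> (add_mset s x) - create b \<phi> x =
      (\<Sum>r\<in>D. b r * (count x r / lam r * (\<phi> (add_mset s (x - {#r#})) - \<phi> (x - {#r#})) - (\<phi> (add_mset s x) - \<phi> x)))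
      + b s * (\<phi> x / lam s)" if "s \<in> D" for s
  proof -
    have "create b \<phi> (add_mset s x) - create b \<phi> x =
        (\<Sum>r\<in>D. b r * (count x r / lam r * (\<phi> (add_mset s (x - {#r#})) - \<phi> (x - {#r#})) - (\<phi> (add_mset s x) - \<phi> x))
          + (if r = s then b s * (\<phi> x / lam s) else 0))"
      unfolding create_def step sum_subtractf[symmetric]
      by (intro sum.cong refl) (simp add: algebra_simps)
    then show ?thesis using that by (simp add: sum.distrib)
  qed
  then have "annihilate a (create b \<phi>) x = (\<Sum>s\<in>D. a s * ((\<Sum>r\<in>D. b r * (count x r / lam r *
      (\<phi> (add_mset s (x - {#r#})) - \<phi> (x - {#r#})) - (\<phi> (add_mset s x) - \<phi> x))) + b s * (\<phi> x / lam s)))"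
    by (simp add: annihilate_def)
  also have "\<dots> = (\<Sum>r\<in>D. \<Sum>s\<in>D. a s * (b r * (count x r / lam r *
      (\<phi> (add_mset s (x - {#r#})) - \<phi> (x - {#r#})) - (\<phi> (add_mset s x) - \<phi> x)))) + ip a b * \<phi> x"
    by (subst sum.swap) (simp add: distrib_left sum.distrib sum_distrib_left sum_distrib_right ip_def mult.assoc)
  also have "(\<Sum>r\<in>D. \<Sum>s\<in>D. a s * (b r * (count x r / lam r *
      (\<phi> (add_mset s (x - {#r#})) - \<phi> (x - {#r#})) - (\<phi> (add_mset s x) - \<phi> x)))) = create b (annihilate a \<phi>) x"
    by (simp add: create_def annihilate_def sum_distrib_left right_diff_distrib sum_subtractf mult_ac)
  finally show ?thesis by simp
qed

section \<open>Charlier polynomials and the L2 bound\<close>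

text \<open>Creation operators applied to the constant 1, the vacuum of the Fock space picture; the
  explicit polynomials are never written out.\<close>

fun charlier :: "('i \<Rightarrow> real) list \<Rightarrow> 'i multiset \<Rightarrow> real" where
  "charlier [] = (\<lambda>_. 1)"
| "charlier (a # as) = create a (charlier as)"

lemma poly_growth_charlier: "poly_growth (charlier as)"
  by (induction as) (auto intro: poly_growth_const poly_growth_create)

lemma create_cmult_sum:
  "create b (\<lambda>x. \<Sum>i\<in>A. c i * \<phi> i x) x = (\<Sum>i\<in>A. c i * create b (\<phi> i) x)"
proof -
  have "create b (\<lambda>x. \<Sum>i\<in>A. c i * \<phi> i x) x =
      (\<Sum>r\<in>D. \<Sum>i\<in>A. c i * (b r * (count x r / lam r * \<phi> i (x - {#r#}) - \<phi> i x)))"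
    unfolding create_def by (simp add: sum_distrib_left sum_subtractf right_diff_distrib mult_ac)
  then show ?thesis
    by (subst (asm) sum.swap) (simp add: create_def sum_distrib_left)
qed

text \<open>The annihilator is moved past one creator after the other, leaving a scalar at each, and
  kills the constant 1 at the end. The list with \<open>take\<close> and \<open>drop\<close> is
  \<open>bs\<close> with entry i removed.\<close>

lemma annihilate_charlier:
  "annihilate a (charlier bs) x =
    (\<Sum>i<length bs. ip a (bs ! i) * charlier (take i bs @ drop (Suc i) bs) x)"
proof (induction bs arbitrary: x)
  case (Cons b bs)
  have "annihilate a (charlier (b # bs)) x = ip a b * charlier bs x + create b (annihilate a (charlier bs)) x"
    by (simp add: annihilate_create)
  also have "annihilate a (charlier bs) = (\<lambda>x. \<Sum>i<length bs. ip a (bs ! i) * charlier (take i bs @ drop (Suc i) bs) x)"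
    using Cons by blast
  finally show ?case
    by (simp add: create_cmult_sum sum.lessThan_Suc_shift del: sum.lessThan_Suc)
qed (simp add: annihilate_def)

definition nrm :: "('i \<Rightarrow> real) \<Rightarrow> real" where
  "nrm a = sqrt (ip a a)"

lemma nrm_nonneg: "0 \<le> nrm a"
  unfolding nrm_def ip_def using lam_pos
  by (auto intro!: sum_nonneg divide_nonneg_pos)

lemma abs_ip_le: "\<bar>ip a b\<bar> \<le> nrm a * nrm b"
proof -
  have "\<bar>ip a b\<bar> \<le> (\<Sum>r\<in>D. \<bar>a r / sqrt (lam r)\<bar> * \<bar>b r / sqrt (lam r)\<bar>)"
    unfolding ip_def using less_imp_le[OF lam_pos]
    by (intro order_trans[OF sum_abs] sum_mono) (simp add: abs_mult)
  also have "\<dots> \<le> L2_set (\<lambda>r. a r / sqrt (lam r)) D * L2_set (\<lambda>r. b r / sqrt (lam r)) D"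
    by (rule L2_set_mult_ineq)
  also have "\<dots> = nrm a * nrm b"
  proof -
    have "L2_set (\<lambda>r. a r / sqrt (lam r)) D = nrm a" for a
      unfolding L2_set_def nrm_def ip_def using less_imp_le[OF lam_pos]
      by (intro arg_cong[of _ _ sqrt] sum.cong) (auto simp: power_divide power2_eq_square)
    then show ?thesis by simp
  qed
  finally show ?thesis .
qed

lemma expect_one: "\<bar>expect (\<lambda>_. 1)\<bar> \<le> 1"
proof -
  have "expect (\<lambda>_. 1) = norm weight"
    unfolding expect_def norm_l1_def by (intro infsum_cong) (simp add: weight_nonneg)
  then show ?thesis using norm_weight_le by simp
qed

abbreviation nrms :: "('i \<Rightarrow> real) list \<Rightarrow> real" where
  "nrms as \<equiv> prod_list (map nrm as)"

lemma nrms_nonneg: "0 \<le> nrms as"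
  by (induction as) (auto intro: mult_nonneg_nonneg nrm_nonneg)

lemma nrms_remove: "i < length bs \<Longrightarrow> nrm (bs ! i) * nrms (take i bs @ drop (Suc i) bs) = nrms bs"
  by (subst (3) id_take_nth_drop[of i bs]) (simp_all add: mult_ac)

text \<open>A creator on the left becomes an annihilator on the right and produces one term per
  entry of \<open>bs\<close>, whence the factorial; the expectation is in effect a permanent of the
  matrix of inner products. Two lists of equal length are needed in the induction, because deleting
  an arbitrary entry destroys equality of the lists.\<close>

lemma expect_charlier_bound:
  "length as = length bs \<Longrightarrow>
    \<bar>expect (\<lambda>x. charlier as x * charlier bs x)\<bar> \<le> fact (length bs) * nrms as * nrms bs"
proof (induction as arbitrary: bs)
  case Nil
  then show ?case using expect_one by simp
next
  case (Cons a as)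
  define m where "m = length as"
  have len: "length bs = Suc m" using Cons.prems by (simp add: m_def)
  let ?bs = "\<lambda>i. take i bs @ drop (Suc i) bs"
  have "expect (\<lambda>x. charlier (a # as) x * charlier bs x) =
      expect (\<lambda>x. charlier as x * annihilate a (charlier bs) x)"
    by (simp add: expect_create_mult poly_growth_charlier)
  also have "\<dots> = expect (\<lambda>x. \<Sum>i<length bs. ip a (bs ! i) * (charlier as x * charlier (?bs i) x))"
    by (simp add: annihilate_charlier sum_distrib_left mult_ac)
  also have "\<dots> = (\<Sum>i<length bs. ip a (bs ! i) * expect (\<lambda>x. charlier as x * charlier (?bs i) x))"
    by (subst expect_sum) (auto intro!: poly_growth_intros poly_growth_charlier simp: expect_cmult)
  also have "\<bar>\<dots>\<bar> \<le> (\<Sum>i<length bs. fact m * (nrm a * nrms as) * nrms bs)"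
  proof (rule order_trans[OF sum_abs], rule sum_mono)
    fix i assume "i \<in> {..<length bs}"
    then have i: "i < length bs" by simp
    then have "length as = length (?bs i)" by (simp add: len m_def)
    from Cons.IH[OF this] have IH: "\<bar>expect (\<lambda>x. charlier as x * charlier (?bs i) x)\<bar> \<le> fact m * nrms as * nrms (?bs i)"
      using i len by (simp add: m_def)
    have "\<bar>ip a (bs ! i) * expect (\<lambda>x. charlier as x * charlier (?bs i) x)\<bar>
        \<le> (nrm a * nrm (bs ! i)) * (fact m * nrms as * nrms (?bs i))"
      unfolding abs_mult by (intro mult_mono IH abs_ip_le mult_nonneg_nonneg nrm_nonneg) simp
    also have "\<dots> = fact m * (nrm a * nrms as) * (nrm (bs ! i) * nrms (?bs i))" by (simp only: mult_ac)
    finally show "\<bar>ip a (bs ! i) * expect (\<lambda>x. charlier as x * charlier (?bs i) x)\<bar>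
        \<le> fact m * (nrm a * nrms as) * nrms bs"
      unfolding nrms_remove[OF i] .
  qed
  also have "\<dots> = fact (length bs) * nrms (a # as) * nrms bs"
    by (simp add: len algebra_simps)
  finally show ?case .
qed

text \<open>This dictates the form of \<open>create\<close>: multiplication by a generator shifts
  the weight, and by the Poisson recursion the shifted weight is the weight times count /
  lam.\<close>

lemma coeff_increments_weight:
  "coeff (prod_list (map increment as) * weight) x = coeff weight x * charlier as x"
proof (induction as arbitrary: x)
  case (Cons a as)
  have IH: "coeff (prod_list (map increment as) * weight) = (\<lambda>y. coeff weight y * charlier as y)"
    using Cons by blast
  have "coeff (prod_list (map increment (a # as)) * weight) x =
      (\<Sum>s\<in>D. a s * (shift_down s (\<lambda>y. coeff weight y * charlier as y) x - coeff weight x * charlier as x))"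
    by (simp add: mult.assoc coeff_increment_times IH)
  also have "\<dots> = (\<Sum>s\<in>D. a s * (coeff weight x * (count x s / lam s * charlier as (x - {#s#})) - coeff weight x * charlier as x))"
  proof (intro sum.cong refl)
    fix s assume "s \<in> D"
    then have "coeff weight x * (count x s / lam s) = shift_down s (coeff weight) x"
      using count_coeff_weight[of x s] lam_pos[of s] by (simp add: field_simps)
    then have "coeff weight x * (count x s / lam s * charlier as (x - {#s#})) = shift_down s (\<lambda>y. coeff weight y * charlier as y) x"
      by (simp only: mult.assoc[symmetric]) (simp add: shift_down_def)
    then show "a s * (shift_down s (\<lambda>y. coeff weight y * charlier as y) x - coeff weight x * charlier as x) =
        a s * (coeff weight x * (count x s / lam s * charlier as (x - {#s#})) - coeff weight x * charlier as x)"
      by simp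
  qed
  also have "\<dots> = coeff weight x * charlier (a # as) x"
    by (simp add: create_def sum_distrib_left algebra_simps)
  finally show ?case .
qed simp

theorem norm_increments_weight_le:
  "norm (prod_list (map increment as) * weight) \<le> sqrt (fact (length as)) * nrms as"
proof -
  define c where "c = sqrt (fact (length as)) * nrms as"
  have c: "0 \<le> c" by (simp add: c_def nrms_nonneg)
  have "expect (\<lambda>x. (charlier as x)\<^sup>2) \<le> c\<^sup>2"
    using expect_charlier_bound[of as as] by (simp add: c_def power_mult_distrib power2_eq_square[of "nrms as"] power2_eq_square[of "charlier as _"] mult_ac)
  moreover have pg: "poly_growth (\<lambda>x. (charlier as x)\<^sup>2)"
    unfolding power2_eq_square by (intro poly_growth_mult poly_growth_charlier)
  ultimately have sq: "expect (\<lambda>x. (charlier as x)\<^sup>2) \<le> t\<^sup>2" if "c \<le> t" for t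
    using c that by (meson order_trans power_mono)
  have pa: "poly_growth (\<lambda>x. \<bar>charlier as x\<bar>)"
    using poly_growth_charlier[of as] by (simp add: poly_growth_def)
  have eq: "norm (prod_list (map increment as) * weight) = expect (\<lambda>x. \<bar>charlier as x\<bar>)"
    unfolding norm_l1_def expect_def by (simp add: coeff_increments_weight abs_mult weight_nonneg)
  have "expect (\<lambda>x. \<bar>charlier as x\<bar>) \<le> c + e" if "e > 0" for e
  proof -
    define t where "t = c + e"
    have t: "t > 0" "c \<le> t" using c that by (auto simp: t_def)
    \<comment> \<open>Cauchy-Schwarz against the constant 1, in the form of the inequality of
      arithmetic and geometric means. Since \<open>c\<close> can be 0, the division is by t = c +
      e.\<close>
    have "\<bar>h\<bar> \<le> t / 2 * 1 + inverse (2 * t) * h\<^sup>2" for h :: real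
    proof -
      have "0 \<le> (t - \<bar>h\<bar>)\<^sup>2" by simp
      then have "2 * t * \<bar>h\<bar> \<le> t\<^sup>2 + h\<^sup>2" by (simp add: power2_diff algebra_simps)
      then show ?thesis using t(1) by (simp add: field_simps power2_eq_square)
    qed
    then have "expect (\<lambda>x. \<bar>charlier as x\<bar>) \<le> expect (\<lambda>x. t / 2 * 1 + inverse (2 * t) * (charlier as x)\<^sup>2)"
      by (intro expect_mono pa poly_growth_intros pg)
    also have "\<dots> = t / 2 * expect (\<lambda>_. 1) + inverse (2 * t) * expect (\<lambda>x. (charlier as x)\<^sup>2)"
      by (subst expect_add) (intro poly_growth_intros pg | simp only: expect_cmult)+
    also have "\<dots> \<le> t / 2 * 1 + inverse (2 * t) * t\<^sup>2"
      using t sq[OF t(2)] expect_one by (intro add_mono mult_left_mono) auto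
    also have "\<dots> = t" using t by (simp add: field_simps power2_eq_square)
    finally show ?thesis by (simp add: t_def)
  qed
  then show ?thesis unfolding eq c_def[symmetric] by (rule field_le_epsilon)
qed

end

section \<open>Kerstan's expansion\<close>

text \<open>Formally (1 - (1 - X) e^X) / X^2, written as a series since X need not be invertible. At
  a real argument it is half of \<open>g_fun\<close>.\<close>

definition kerstan_series :: "'a::{real_normed_algebra_1, banach} \<Rightarrow> 'a" where
  "kerstan_series X = (\<Sum>m. (real (m + 1) / fact (m + 2)) *\<^sub>R X ^ m)"

lemma kerstan_coeff_le: "real (m + 1) / fact (m + 2) \<le> inverse (fact m)"
proof -
  have "real (m + 1) * fact m \<le> real (m + 2) * (real (m + 1) * fact m)"
    by (simp add: distrib_right)
  then have le: "real (m + 1) * fact m \<le> fact (m + 2)" by (simp add: algebra_simps)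
  have "a / c \<le> inverse b" if "a * b \<le> c" "0 < b" "0 < c" for a b c :: real
    using that by (simp add: field_simps)
  from this[OF le fact_gt_zero fact_gt_zero] show ?thesis .
qed

lemma summable_kerstan_norm:
  fixes X :: "'a::{real_normed_algebra_1, banach}"
  assumes "norm X \<le> z"
  shows "summable (\<lambda>m. norm ((real (m + 1) / fact (m + 2)) *\<^sub>R X ^ m))"
    and "summable (\<lambda>m. real (m + 1) / fact (m + 2) * z ^ m)"
    and "norm ((real (m + 1) / fact (m + 2)) *\<^sub>R X ^ m) \<le> real (m + 1) / fact (m + 2) * z ^ m"
proof -
  have z: "0 \<le> z" using assms norm_ge_zero order_trans by blast
  show 2: "summable (\<lambda>m. real (m + 1) / fact (m + 2) * z ^ m)"
  proof (rule summable_comparison_test')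
    show "summable (\<lambda>m. inverse (fact m) * z ^ m)" by (rule summable_exp)
    show "norm (real (m + 1) / fact (m + 2) * z ^ m) \<le> inverse (fact m) * z ^ m" if "m \<ge> 0" for m
      using z mult_right_mono[OF kerstan_coeff_le[of m], of "z ^ m"] by simp
  qed
  show 3: "norm ((real (m + 1) / fact (m + 2)) *\<^sub>R X ^ m) \<le> real (m + 1) / fact (m + 2) * z ^ m" for m
  proof -
    have "norm (X ^ m) \<le> z ^ m"
      using norm_power_ineq[of X m] power_mono[OF assms norm_ge_zero, of m] by linarith
    then have "real (m + 1) / fact (m + 2) * norm (X ^ m) \<le> real (m + 1) / fact (m + 2) * z ^ m"
      by (intro mult_left_mono) auto
    then show ?thesis by simp
  qed
  show "summable (\<lambda>m. norm ((real (m + 1) / fact (m + 2)) *\<^sub>R X ^ m))"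
    by (rule summable_comparison_test'[OF 2]) (use 3 in simp)
qed

lemma norm_kerstan_series_le: "norm X \<le> z \<Longrightarrow> norm (kerstan_series X) \<le> g_fun z / 2"
  unfolding kerstan_series_def g_fun_def
  using summable_norm[OF summable_kerstan_norm(1)[of X z]]
    suminf_le[OF summable_kerstan_norm(3)[of X z] summable_kerstan_norm(1,2)[of X z]]
  by linarith

text \<open>Half of \<open>g_fun z\<close> bounds a norm, already for X = 0.\<close>

lemma g_fun_nonneg: "0 \<le> z \<Longrightarrow> 0 \<le> g_fun z"
  using norm_kerstan_series_le[of "0::real" z] norm_ge_zero[of "kerstan_series (0::real)"] by simp

text \<open>Comparison of coefficients: X^(m+2) occurs in (1 - X) e^X with 1/(m+2)! - 1/(m+1)! =
  -(m+1)/(m+2)!, and the terms of order 0 and 1 reduce to the constant 1.\<close>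

lemma one_minus_times_exp:
  fixes X :: "'a::{real_normed_algebra_1, banach, comm_ring_1}"
  shows "(1 - X) * exp X - 1 = - (X\<^sup>2 * kerstan_series X)"
proof -
  have e: "(\<lambda>m. X ^ m /\<^sub>R fact m) sums exp X"
    unfolding exp_def by (rule summable_sums[OF summable_exp_generic])
  have 2: "(\<lambda>m. X ^ (m + 2) /\<^sub>R fact (m + 2)) sums (exp X - (1 + X))"
    using sums_split_initial_segment[OF e, of 2] by (simp add: numeral_2_eq_2)
  have "(\<lambda>m. X ^ (m + 1) /\<^sub>R fact (m + 1)) sums (exp X - 1)"
    using sums_split_initial_segment[OF e, of 1] by simp
  then have 1: "(\<lambda>m. X * (X ^ (m + 1) /\<^sub>R fact (m + 1))) sums (X * (exp X - 1))"
    by (rule sums_mult)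
  have "(\<lambda>m. X ^ (m + 2) /\<^sub>R fact (m + 2) - X * (X ^ (m + 1) /\<^sub>R fact (m + 1))) sums
      (exp X - (1 + X) - X * (exp X - 1))"
    by (rule sums_diff[OF 2 1])
  moreover have "X ^ (m + 2) /\<^sub>R fact (m + 2) - X * (X ^ (m + 1) /\<^sub>R fact (m + 1)) =
      - (X\<^sup>2 * ((real (m + 1) / fact (m + 2)) *\<^sub>R X ^ m))" for m
  proof -
    have c: "inverse (fact (m + 2)) - inverse (fact (m + 1)) = - (real (m + 1) / fact (m + 2))"
    proof -
      have "inverse (b * c) - inverse c = - ((b - 1) / (b * c))" if "b \<noteq> 0" "c \<noteq> 0" for b c :: real
        using that by (simp add: field_simps)
      from this[of "real (m + 2)" "fact (m + 1)"] show ?thesis by simp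
    qed
    have "X ^ (m + 2) /\<^sub>R fact (m + 2) - X * (X ^ (m + 1) /\<^sub>R fact (m + 1)) =
        (inverse (fact (m + 2)) - inverse (fact (m + 1))) *\<^sub>R X ^ (m + 2)"
      by (simp add: scaleR_left_diff_distrib)
    also have "\<dots> = - (X\<^sup>2 * ((real (m + 1) / fact (m + 2)) *\<^sub>R X ^ m))"
      unfolding c by (simp add: power2_eq_square mult.assoc)
    finally show ?thesis .
  qed
  ultimately have "(\<lambda>m. - (X\<^sup>2 * ((real (m + 1) / fact (m + 2)) *\<^sub>R X ^ m))) sums
      (exp X - (1 + X) - X * (exp X - 1))" by simp
  moreover have "(\<lambda>m. - (X\<^sup>2 * ((real (m + 1) / fact (m + 2)) *\<^sub>R X ^ m))) sums - (X\<^sup>2 * kerstan_series X)"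
    unfolding kerstan_series_def
    by (intro sums_minus sums_mult summable_sums summable_norm_cancel[OF summable_kerstan_norm(1)[of X "norm X"]]) simp
  ultimately have "exp X - (1 + X) - X * (exp X - 1) = - (X\<^sup>2 * kerstan_series X)"
    by (rule sums_unique2)
  then show ?thesis by (simp add: algebra_simps)
qed

section \<open>Elementary symmetric sums and the growth of the constants\<close>

text \<open>Pascal's recursion for elementary symmetric polynomials: the sets J are split according
  to whether they contain a.\<close>

lemma sum_subsets_card_insert:
  fixes z :: "'j \<Rightarrow> 'a::comm_semiring_1"
  assumes "finite N" "a \<notin> N"
  shows "(\<Sum>J | J \<subseteq> insert a N \<and> card J = Suc k. prod z J) =
    (\<Sum>J | J \<subseteq> N \<and> card J = Suc k. prod z J) + z a * (\<Sum>J | J \<subseteq> N \<and> card J = k. prod z J)"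
proof -
  have fin: "finite J" if "J \<subseteq> N" for J using assms(1) that finite_subset by blast
  have "{J. J \<subseteq> insert a N \<and> card J = Suc k} =
      {J. J \<subseteq> N \<and> card J = Suc k} \<union> insert a ` {J. J \<subseteq> N \<and> card J = k}" (is "?L = ?A \<union> ?B")
  proof (intro equalityI subsetI)
    fix J assume J: "J \<in> ?L"
    show "J \<in> ?A \<union> ?B"
    proof (cases "a \<in> J")
      case True
      then have "J = insert a (J - {a})" "J - {a} \<subseteq> N" "card (J - {a}) = k" using J by auto
      then show ?thesis by blast
    qed (use J in auto)
  next
    fix J assume "J \<in> ?A \<union> ?B"
    then show "J \<in> ?L"
    proof
      assume "J \<in> ?B"
      then obtain I where I: "I \<subseteq> N" "card I = k" "J = insert a I" by blast
      then have "a \<notin> I" using assms(2) by blast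
      with I fin[OF I(1)] show ?thesis by auto
    qed auto
  qed
  moreover have "?A \<inter> ?B = {}" using assms(2) by auto
  moreover have "finite ?A" "finite ?B" using assms(1) by auto
  ultimately have "(\<Sum>J\<in>?L. prod z J) = (\<Sum>J\<in>?A. prod z J) + (\<Sum>J\<in>?B. prod z J)"
    by (simp add: sum.union_disjoint)
  also have "(\<Sum>J\<in>?B. prod z J) = (\<Sum>J | J \<subseteq> N \<and> card J = k. prod z (insert a J))"
    by (subst sum.reindex) (use assms(2) in \<open>auto simp: inj_on_def insert_ident subset_iff\<close>)
  also have "\<dots> = z a * (\<Sum>J | J \<subseteq> N \<and> card J = k. prod z J)"
    unfolding sum_distrib_left
    by (intro sum.cong refl) (use assms(2) fin in \<open>auto intro!: prod.insert\<close>)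
  finally show ?thesis .
qed

text \<open>In the expansion of the k-th power of the sum every squarefree monomial occurs k! times
  and all other terms are nonnegative. The induction reaches this through Pascal's
  recursion.\<close>

lemma sum_subsets_card_le:
  fixes z :: "'j \<Rightarrow> real"
  assumes "finite N" "\<And>j. j \<in> N \<Longrightarrow> 0 \<le> z j"
  shows "(\<Sum>J | J \<subseteq> N \<and> card J = k. prod z J) \<le> (sum z N) ^ k / fact k"
  using assms
proof (induction N arbitrary: k rule: finite_induct)
  case empty
  have "{J :: 'j set. J = {} \<and> card J = k} = (if k = 0 then {{}} else {})" by auto
  then show ?case by (simp add: zero_power)
next
  case (insert a N)
  show ?case
  proof (cases k)
    case 0
    have "{J. J \<subseteq> insert a N \<and> card J = 0} = {{}}"
      using insert.hyps(1) by (auto dest: finite_subset)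
    then show ?thesis by (simp add: 0)
  next
    case (Suc m)
    define s where "s = sum z N"
    have s: "0 \<le> s" "0 \<le> z a" using insert.prems by (auto simp: s_def intro: sum_nonneg)
    \<comment> \<open>The first two terms of the binomial expansion; they are precisely what
      Pascal's recursion produces from the induction hypothesis.\<close>
    have bern: "s ^ Suc m + real (Suc m) * z a * s ^ m \<le> (s + z a) ^ Suc m" for m
    proof (induction m)
      case (Suc m)
      have "s ^ Suc (Suc m) + real (Suc (Suc m)) * z a * s ^ Suc m
          \<le> (s + z a) * (s ^ Suc m + real (Suc m) * z a * s ^ m)"
        using s by (simp add: algebra_simps)
      also have "\<dots> \<le> (s + z a) * (s + z a) ^ Suc m"
        using Suc s by (intro mult_left_mono) auto
      finally show ?case by simp
    qed simp
    have "(\<Sum>J | J \<subseteq> insert a N \<and> card J = k. prod z J) \<le> s ^ Suc m / fact (Suc m) + z a * (s ^ m / fact m)"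
      unfolding Suc sum_subsets_card_insert[OF insert.hyps] s_def
      by (intro add_mono mult_left_mono insert.IH) (auto intro: insert.prems)
    also have "\<dots> = (s ^ Suc m + real (Suc m) * z a * s ^ m) / fact (Suc m)"
      by (simp add: add_divide_distrib del: of_nat_Suc)
    also have "\<dots> \<le> (s + z a) ^ Suc m / fact (Suc m)"
      by (intro divide_right_mono bern) simp
    also have "s + z a = sum z (insert a N)" using insert.hyps by (simp add: s_def)
    finally show ?thesis by (simp add: Suc)
  qed
qed

text \<open>
  Replacing a quadratic factor by a trivially bounded one costs a factor 2 in the trivial bound;
  the growth of \<open>sqrt ((2k)!)\<close> pays for it.
\<close>

lemma central_growth:
  assumes "i \<le> k"
  shows "sqrt (fact (2 * i)) * (2 * sqrt 2) ^ i * 4 ^ (k - i) \<le> sqrt (fact (2 * k)) * (2 * sqrt 2) ^ k"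
  using assms
proof (induction k rule: dec_induct)
  case (step k)
  \<comment> \<open>Since 4 = sqrt 2 (2 sqrt 2), one further trivial factor asks for only sqrt 2
    from the factorials, and (2k + 2)(2k + 1) is at least 2.\<close>
  have "sqrt 2 * sqrt (fact (2 * k)) \<le> sqrt (fact (2 * Suc k))"
    unfolding real_sqrt_mult[symmetric]
  proof (rule real_sqrt_le_mono)
    have "2 * fact (2 * k) \<le> real (2 * k + 2) * (real (2 * k + 1) * fact (2 * k))"
      by (simp add: algebra_simps)
    also have "\<dots> = fact (2 * Suc k)" by (simp add: algebra_simps)
    finally show "2 * fact (2 * k) \<le> (fact (2 * Suc k) :: real)" .
  qed
  then have le: "(sqrt 2 * sqrt (fact (2 * k))) * ((2 * sqrt 2) ^ k * (2 * sqrt 2)) \<le> sqrt (fact (2 * Suc k)) * ((2 * sqrt 2) ^ k * (2 * sqrt 2))"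
    by (rule mult_right_mono) simp
  have "sqrt (fact (2 * i)) * (2 * sqrt 2) ^ i * 4 ^ (Suc k - i) = sqrt (fact (2 * i)) * (2 * sqrt 2) ^ i * 4 ^ (k - i) * 4"
    using step by (simp add: Suc_diff_le)
  also have "\<dots> \<le> sqrt (fact (2 * k)) * (2 * sqrt 2) ^ k * 4"
    using step.IH by (rule mult_right_mono) simp
  also have "\<dots> = (sqrt 2 * sqrt (fact (2 * k))) * ((2 * sqrt 2) ^ k * (2 * sqrt 2))"
    by simp
  also note le
  also have "sqrt (fact (2 * Suc k)) * ((2 * sqrt 2) ^ k * (2 * sqrt 2)) = sqrt (fact (2 * Suc k)) * (2 * sqrt 2) ^ Suc k"
    by (simp only: power_Suc2)
  finally show ?case .
qed simp

text \<open>From (2k + 2)(2k + 1) \<le> (2(k + 1))^2 the quotient sqrt((2k)!)/k! at most doubles.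
  Together with the additional sqrt 2 this is the ratio 2^(3/2) of the geometric series in the final
  bound.\<close>

lemma central_ratio:
  "sqrt (fact (2 * Suc k)) / fact (Suc k) * sqrt 2 ^ Suc k \<le> 2 * sqrt 2 * (sqrt (fact (2 * k)) / fact k * sqrt 2 ^ k)"
proof -
  have "sqrt (fact (2 * Suc k)) \<le> sqrt ((2 * real (Suc k))\<^sup>2 * fact (2 * k))"
  proof (rule real_sqrt_le_mono)
    have "fact (2 * Suc k) = real (2 * k + 2) * (real (2 * k + 1) * fact (2 * k))" by (simp add: algebra_simps)
    also have "\<dots> \<le> real (2 * k + 2) * (real (2 * k + 2) * fact (2 * k))"
      by (intro mult_left_mono mult_right_mono) auto
    also have "\<dots> = (2 * real (Suc k))\<^sup>2 * fact (2 * k)" by (simp add: power2_eq_square algebra_simps)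
    finally show "fact (2 * Suc k) \<le> (2 * real (Suc k))\<^sup>2 * (fact (2 * k) :: real)" .
  qed
  also have "\<dots> = 2 * real (Suc k) * sqrt (fact (2 * k))"
    by (simp add: real_sqrt_mult)
  finally have "sqrt (fact (2 * Suc k)) / fact (Suc k) \<le> (2 * real (Suc k) * sqrt (fact (2 * k))) / fact (Suc k)"
    by (rule divide_right_mono) simp
  also have "\<dots> = 2 * (sqrt (fact (2 * k)) / fact k)"
    by (simp add: divide_simps del: of_nat_Suc)
  finally have "sqrt (fact (2 * Suc k)) / fact (Suc k) * sqrt 2 ^ Suc k \<le> 2 * (sqrt (fact (2 * k)) / fact k) * sqrt 2 ^ Suc k"
    by (rule mult_right_mono) simp
  also have "\<dots> = 2 * sqrt 2 * (sqrt (fact (2 * k)) / fact k * sqrt 2 ^ k)" by simp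
  finally show ?thesis .
qed

context poisson_weights
begin

lemma norm_increment_squares_weight_le:
  assumes "finite I"
  shows "norm ((\<Prod>j\<in>I. (increment (a j))\<^sup>2) * weight) \<le> sqrt (fact (2 * card I)) * (\<Prod>j\<in>I. ip (a j) (a j))"
proof -
  obtain js where js: "set js = I" "distinct js" using finite_distinct_list[OF assms] by blast
  have len: "length js = card I" using js distinct_card by fastforce
  \<comment> \<open>Each index is listed twice: the list has length 2 card I, and each squared
    \<open>nrm\<close> is an \<open>ip\<close>.\<close>
  have "norm (prod_list (map increment (map a js @ map a js)) * weight)
      \<le> sqrt (fact (length (map a js @ map a js))) * nrms (map a js @ map a js)"
    by (rule norm_increments_weight_le)
  also have "prod_list (map increment (map a js @ map a js)) = (\<Prod>j\<in>I. (increment (a j))\<^sup>2)"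
    using prod.distinct_set_conv_list[OF js(2), of "\<lambda>j. increment (a j)"] js(1)
    by (simp add: o_def prod.distrib power2_eq_square)
  also have "nrms (map a js @ map a js) = (\<Prod>j\<in>I. ip (a j) (a j))"
  proof -
    have "ip (a j) (a j) = nrm (a j) * nrm (a j)" for j
      using nrm_nonneg[of "a j"] by (simp add: nrm_def)
    then show ?thesis
      using prod.distinct_set_conv_list[OF js(2), of "\<lambda>j. nrm (a j)"] js(1)
      by (simp add: o_def prod.distrib)
  qed
  finally show ?thesis by (simp add: len mult_2)
qed

lemma norm_increment_le: "norm (increment a) \<le> 2 * (\<Sum>r\<in>D. \<bar>a r\<bar>)"
proof -
  have "norm (gen r - 1 :: 'i multiset l1) \<le> 2" for r
    using norm_triangle_ineq4[of "gen r" "1 :: 'i multiset l1"] by simp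
  then have "norm (increment a) \<le> (\<Sum>r\<in>D. \<bar>a r\<bar> * 2)"
    unfolding increment_def by (intro order_trans[OF norm_sum] sum_mono) (auto intro!: mult_left_mono)
  then show ?thesis by (simp add: sum_distrib_left mult.commute)
qed

lemma increment_add: "increment a + increment b = increment (\<lambda>r. a r + b r)"
  by (simp add: increment_def sum.distrib scaleR_left_distrib)

lemma increment_diff: "increment a - increment b = increment (\<lambda>r. a r - b r)"
  by (simp add: increment_def sum_subtractf scaleR_left_diff_distrib)

end

section \<open>The expansion of the product and its norm estimates\<close>

locale kerstan =
  fixes N :: "'j set" and D :: "'i set" and p :: "'j \<Rightarrow> real" and q :: "'j \<Rightarrow> 'i \<Rightarrow> real"
  assumes finite_N [simp]: "finite N" and finite_D': "finite D"
    and p_nonneg: "j \<in> N \<Longrightarrow> 0 \<le> p j"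
    and q_nonneg: "j \<in> N \<Longrightarrow> r \<in> D \<Longrightarrow> 0 \<le> q j r"
    and q_sum: "j \<in> N \<Longrightarrow> (\<Sum>r\<in>D. q j r) = 1"
    and rate_pos: "r \<in> D \<Longrightarrow> 0 < (\<Sum>j\<in>N. p j * q j r)"
begin

definition rate :: "'i \<Rightarrow> real" where "rate r = (\<Sum>j\<in>N. p j * q j r)"

sublocale poisson_weights D rate
  by standard (auto simp: rate_def finite_D' rate_pos)

definition R :: "'j \<Rightarrow> 'i multiset l1" where "R j = increment (\<lambda>r. p j * q j r)"

lemma R_eq: "j \<in> N \<Longrightarrow> R j = p j *\<^sub>R ((\<Sum>r\<in>D. q j r *\<^sub>R gen r) - 1)"
  using q_sum[of j]
  by (simp add: R_def increment_def scaleR_diff_right sum_subtractf scaleR_sum_right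
      flip: scaleR_sum_left sum_distrib_left)

definition V :: "'j \<Rightarrow> 'i multiset l1" where "V j = (1 + R j) * exp (- R j) - 1"

definition H :: "nat \<Rightarrow> 'i multiset l1" where
  "H k = (\<Sum>J | J \<subseteq> N \<and> card J = k. prod V J) * exp (\<Sum>j\<in>N. R j)"

definition \<alpha> :: real where
  "\<alpha> = (\<Sum>j\<in>N. g_fun (2 * p j) * (p j)\<^sup>2 * (\<Sum>r\<in>D. q j r * min (q j r / (2 * sqrt 2 * rate r)) 2))"

text \<open>Summing over j first collects the coefficients into the rates, so a single Poisson
  weight serves every \<open>H k\<close>.\<close>

lemma exp_sum_R: "exp (\<Sum>j\<in>N. R j) = weight"
proof -
  have "(\<Sum>j\<in>N. R j) = (\<Sum>r\<in>D. rate r *\<^sub>R (gen r - 1))"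
    unfolding R_def increment_def rate_def by (subst sum.swap) (simp add: scaleR_sum_left)
  then show ?thesis by (simp add: weight_def)
qed

lemma norm_R: "j \<in> N \<Longrightarrow> norm (R j) \<le> 2 * p j"
  unfolding R_def
  by (rule order_trans[OF norm_increment_le])
     (simp add: abs_mult p_nonneg q_nonneg q_sum flip: sum_distrib_left)

lemma V_eq: "V j = - kerstan_series (- R j) * (R j)\<^sup>2"
  using one_minus_times_exp[of "- R j"] by (simp add: V_def mult.commute)

text \<open>
  On the indices where the minimum in \<open>\<alpha>\<close> is the second argument, the quadratic bound is worse
  than the trivial one; these indices are split off.
\<close>

definition good :: "'j \<Rightarrow> 'i set" where
  "good j = {r \<in> D. q j r / (2 * sqrt 2 * rate r) \<le> 2}"

definition good_coeff :: "'j \<Rightarrow> 'i \<Rightarrow> real" where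
  "good_coeff j r = (if r \<in> good j then p j * q j r else 0)"

text \<open>The divisor 2 sqrt 2 makes \<open>quad_part j + triv_part j\<close> equal to (p j)^2
  times the sum of the minima in \<open>\<alpha>\<close>, each of the two parts taking one branch of
  the minimum.\<close>

definition quad_part :: "'j \<Rightarrow> real" where
  "quad_part j = (p j)\<^sup>2 * (\<Sum>r\<in>good j. q j r * (q j r / (2 * sqrt 2 * rate r)))"

definition triv_part :: "'j \<Rightarrow> real" where
  "triv_part j = (p j)\<^sup>2 * (\<Sum>r\<in>D - good j. q j r * 2)"

lemma good_subset: "good j \<subseteq> D"
  by (auto simp: good_def)

lemma \<alpha>_eq: "\<alpha> = (\<Sum>j\<in>N. g_fun (2 * p j) * (quad_part j + triv_part j))"
proof -
  have "(\<Sum>r\<in>D. q j r * min (q j r / (2 * sqrt 2 * rate r)) 2) =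
      (\<Sum>r\<in>D - good j. q j r * 2) + (\<Sum>r\<in>good j. q j r * (q j r / (2 * sqrt 2 * rate r)))" for j
    by (subst sum.subset_diff[OF good_subset[of j]]) (auto simp: good_def min_def intro!: arg_cong2[of _ _ _ _ "(+)"] sum.cong)
  then show ?thesis by (simp add: \<alpha>_def quad_part_def triv_part_def distrib_left mult.assoc add.commute)
qed

lemma quad_part_nonneg: "j \<in> N \<Longrightarrow> 0 \<le> quad_part j" and triv_part_nonneg: "j \<in> N \<Longrightarrow> 0 \<le> triv_part j"
  unfolding quad_part_def triv_part_def using good_subset[of j]
  by (auto intro!: mult_nonneg_nonneg sum_nonneg divide_nonneg_nonneg q_nonneg less_imp_le[OF lam_pos])

lemma \<alpha>_nonneg: "0 \<le> \<alpha>"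
  unfolding \<alpha>_eq by (intro sum_nonneg mult_nonneg_nonneg add_nonneg_nonneg g_fun_nonneg quad_part_nonneg triv_part_nonneg)
    (simp_all add: p_nonneg)

lemma ip_good_coeff: "ip (good_coeff j) (good_coeff j) = 2 * sqrt 2 * quad_part j"
proof -
  have "ip (good_coeff j) (good_coeff j) = (\<Sum>r\<in>good j. p j * q j r * (p j * q j r) / rate r)"
    unfolding ip_def using good_subset[of j] by (intro sum.mono_neutral_cong_right) (auto simp: good_coeff_def)
  also have "\<dots> = 2 * sqrt 2 * quad_part j"
    by (simp add: quad_part_def sum_distrib_left power2_eq_square mult_ac)
  finally show ?thesis .
qed

text \<open>The difference of squares factors. The first factor sees only the total q-mass b off
  \<open>good j\<close> and is at most 2 p b, the second is at most 4 p; the product 8 p^2 b is four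
  times \<open>triv_part j\<close>.\<close>

lemma norm_remainder:
  assumes "j \<in> N"
  shows "norm ((R j)\<^sup>2 - (increment (good_coeff j))\<^sup>2) \<le> 4 * triv_part j"
proof -
  let ?b = "\<Sum>r\<in>D - good j. q j r"
  have "norm (R j - increment (good_coeff j)) \<le> 2 * (p j * ?b)"
  proof -
    have "(\<Sum>r\<in>D. \<bar>p j * q j r - good_coeff j r\<bar>) = (\<Sum>r\<in>D - good j. p j * q j r)"
      using assms p_nonneg q_nonneg
      by (intro sum.mono_neutral_cong_right) (auto simp: good_coeff_def)
    then show ?thesis
      unfolding R_def increment_diff by (intro order_trans[OF norm_increment_le]) (simp add: sum_distrib_left)
  qed
  moreover have "norm (R j + increment (good_coeff j)) \<le> 4 * p j"
  proof -
    have "(\<Sum>r\<in>D. \<bar>p j * q j r + good_coeff j r\<bar>) \<le> (\<Sum>r\<in>D. 2 * (p j * q j r))"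
      using assms p_nonneg q_nonneg by (intro sum_mono) (auto simp: good_coeff_def)
    also have "\<dots> = 2 * p j" by (simp add: q_sum assms flip: sum_distrib_left)
    finally show ?thesis
      unfolding R_def increment_add by (intro order_trans[OF norm_increment_le]) simp
  qed
  ultimately have "norm (R j - increment (good_coeff j)) * norm (R j + increment (good_coeff j)) \<le> (2 * (p j * ?b)) * (4 * p j)"
    using assms p_nonneg q_nonneg by (intro mult_mono mult_nonneg_nonneg sum_nonneg) auto
  also have "\<dots> = 4 * triv_part j" by (simp add: triv_part_def power2_eq_square sum_distrib_right[symmetric])
  also have "norm ((R j - increment (good_coeff j)) * (R j + increment (good_coeff j))) \<le> norm (R j - increment (good_coeff j)) * norm (R j + increment (good_coeff j))"
    by (rule norm_mult_ineq)
  finally show ?thesis by (simp add: power2_eq_square algebra_simps)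
qed

text \<open>Each square is the square of its good part plus a remainder, and the product is expanded
  over the set I of indices where the good part is chosen. On I the L2 bound is used jointly with
  the weight, off I the plain norm. \<open>central_growth\<close> bounds every constant by one that
  is independent of I, so the sum folds back into a product.\<close>

lemma norm_squares_weight:
  assumes "J \<subseteq> N" "card J = k"
  shows "norm ((\<Prod>j\<in>J. (R j)\<^sup>2) * weight) \<le> sqrt (fact (2 * k)) * (2 * sqrt 2) ^ k * (\<Prod>j\<in>J. quad_part j + triv_part j)"
proof -
  define T where "T j = (R j)\<^sup>2 - (increment (good_coeff j))\<^sup>2" for j
  have fin: "finite J" using assms(1) finite_N by (rule finite_subset)
  have "(\<Prod>j\<in>J. (R j)\<^sup>2) = (\<Prod>j\<in>J. (increment (good_coeff j))\<^sup>2 + T j)" by (simp add: T_def)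
  also have "\<dots> = (\<Sum>I\<in>Pow J. (\<Prod>j\<in>I. (increment (good_coeff j))\<^sup>2) * (\<Prod>j\<in>J - I. T j))"
    by (rule prod_add[OF fin])
  finally have "norm ((\<Prod>j\<in>J. (R j)\<^sup>2) * weight) =
      norm (\<Sum>I\<in>Pow J. ((\<Prod>j\<in>I. (increment (good_coeff j))\<^sup>2) * weight) * (\<Prod>j\<in>J - I. T j))"
    by (simp add: sum_distrib_left sum_distrib_right mult_ac)
  also have "\<dots> \<le> (\<Sum>I\<in>Pow J. sqrt (fact (2 * k)) * (2 * sqrt 2) ^ k * (prod quad_part I * prod triv_part (J - I)))"
  proof (rule order_trans[OF norm_sum], rule sum_mono)
    fix I assume I: "I \<in> Pow J"
    then have finI: "finite I" using fin finite_subset by blast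
    have ci: "card I \<le> k" using I assms(2) card_mono[OF fin] by auto
    have cJI: "card (J - I) = k - card I" using I assms(2) card_Diff_subset[OF finI] by auto
    have nn: "0 \<le> prod quad_part I * prod triv_part (J - I)"
      using I assms(1) by (intro mult_nonneg_nonneg prod_nonneg) (auto intro: quad_part_nonneg triv_part_nonneg)
    have "norm (\<Prod>j\<in>J - I. T j) \<le> (\<Prod>j\<in>J - I. 4 * triv_part j)"
      using assms(1) by (intro order_trans[OF norm_prod_le] prod_mono) (auto simp: T_def intro: norm_remainder)
    moreover have le: "norm ((\<Prod>j\<in>I. (increment (good_coeff j))\<^sup>2) * weight) \<le> sqrt (fact (2 * card I)) * (\<Prod>j\<in>I. 2 * sqrt 2 * quad_part j)"
      using norm_increment_squares_weight_le[OF finI, of good_coeff] by (simp add: ip_good_coeff)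
    ultimately have "norm ((\<Prod>j\<in>I. (increment (good_coeff j))\<^sup>2) * weight) * norm (\<Prod>j\<in>J - I. T j) \<le>
        (sqrt (fact (2 * card I)) * (\<Prod>j\<in>I. 2 * sqrt 2 * quad_part j)) * (\<Prod>j\<in>J - I. 4 * triv_part j)"
      by (intro mult_mono order_trans[OF norm_ge_zero le]) auto
    then have "norm (((\<Prod>j\<in>I. (increment (good_coeff j))\<^sup>2) * weight) * (\<Prod>j\<in>J - I. T j)) \<le>
        (sqrt (fact (2 * card I)) * (\<Prod>j\<in>I. 2 * sqrt 2 * quad_part j)) * (\<Prod>j\<in>J - I. 4 * triv_part j)"
      by (rule order_trans[OF norm_mult_ineq])
    also have "\<dots> = (sqrt (fact (2 * card I)) * (2 * sqrt 2) ^ card I * 4 ^ (k - card I)) * (prod quad_part I * prod triv_part (J - I))"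
      by (simp add: prod.distrib cJI power_mult_distrib)
    also have "\<dots> \<le> (sqrt (fact (2 * k)) * (2 * sqrt 2) ^ k) * (prod quad_part I * prod triv_part (J - I))"
      by (rule mult_right_mono[OF central_growth[OF ci] nn])
    finally show "norm (((\<Prod>j\<in>I. (increment (good_coeff j))\<^sup>2) * weight) * (\<Prod>j\<in>J - I. T j)) \<le>
        sqrt (fact (2 * k)) * (2 * sqrt 2) ^ k * (prod quad_part I * prod triv_part (J - I))" by simp
  qed
  also have "\<dots> = sqrt (fact (2 * k)) * (2 * sqrt 2) ^ k * (\<Prod>j\<in>J. quad_part j + triv_part j)"
    by (simp only: prod_add[OF fin] sum_distrib_left)
  finally show ?thesis .
qed

lemma norm_prod_V_weight:
  assumes "J \<subseteq> N" "card J = k"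
  shows "norm (prod V J * weight) \<le> sqrt (fact (2 * k)) * sqrt 2 ^ k * (\<Prod>j\<in>J. g_fun (2 * p j) * (quad_part j + triv_part j))"
proof -
  have fin: "finite J" using assms(1) finite_N by (rule finite_subset)
  have "prod V J * weight = (\<Prod>j\<in>J. - kerstan_series (- R j)) * ((\<Prod>j\<in>J. (R j)\<^sup>2) * weight)"
    by (simp only: prod.cong[OF refl V_eq] prod.distrib mult.assoc)
  also have "norm \<dots> \<le> (\<Prod>j\<in>J. g_fun (2 * p j) / 2) * (sqrt (fact (2 * k)) * (2 * sqrt 2) ^ k * (\<Prod>j\<in>J. quad_part j + triv_part j))"
  proof (rule order_trans[OF norm_mult_ineq], rule mult_mono[OF _ norm_squares_weight[OF assms]])
    show "norm (\<Prod>j\<in>J. - kerstan_series (- R j)) \<le> (\<Prod>j\<in>J. g_fun (2 * p j) / 2)"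
      using assms(1) by (intro order_trans[OF norm_prod_le] prod_mono) (auto intro!: norm_R norm_kerstan_series_le[unfolded le_divide_eq_numeral1])
    show "0 \<le> (\<Prod>j\<in>J. g_fun (2 * p j) / 2)"
      using assms(1) by (intro prod_nonneg) (auto intro!: g_fun_nonneg p_nonneg)
  qed simp
  \<comment> \<open>The k halves from g/2 turn (2 sqrt 2)^k into sqrt 2^k.\<close>
  also have "\<dots> = sqrt (fact (2 * k)) * sqrt 2 ^ k * (\<Prod>j\<in>J. g_fun (2 * p j) * (quad_part j + triv_part j))"
    by (simp add: prod.distrib prod_dividef assms(2) power_mult_distrib)
  finally show ?thesis .
qed

lemma norm_H: "norm (H k) \<le> sqrt (fact (2 * k)) / fact k * sqrt 2 ^ k * \<alpha> ^ k"
proof -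
  let ?z = "\<lambda>j. g_fun (2 * p j) * (quad_part j + triv_part j)"
  have "norm (H k) \<le> (\<Sum>J | J \<subseteq> N \<and> card J = k. sqrt (fact (2 * k)) * sqrt 2 ^ k * prod ?z J)"
    unfolding H_def exp_sum_R sum_distrib_right
    by (intro order_trans[OF norm_sum] sum_mono norm_prod_V_weight) auto
  also have "\<dots> = sqrt (fact (2 * k)) * sqrt 2 ^ k * (\<Sum>J | J \<subseteq> N \<and> card J = k. prod ?z J)"
    by (simp only: sum_distrib_left)
  also have "\<dots> \<le> sqrt (fact (2 * k)) * sqrt 2 ^ k * ((sum ?z N) ^ k / fact k)"
    by (intro mult_left_mono sum_subsets_card_le mult_nonneg_nonneg add_nonneg_nonneg g_fun_nonneg
        quad_part_nonneg triv_part_nonneg) (simp_all add: p_nonneg)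
  also have "\<dots> = sqrt (fact (2 * k)) / fact k * sqrt 2 ^ k * \<alpha> ^ k"
    by (simp add: \<alpha>_eq)
  finally show ?thesis .
qed

text \<open>Since 1 + R_j = (1 + V_j) exp(R_j), the exponentials combine into one, and the product
  of the 1 + V_j is expanded over subsets, grouped by cardinality.\<close>

lemma prod_eq_sum_H: "(\<Prod>j\<in>N. 1 + R j) = (\<Sum>k\<le>card N. H k)"
proof -
  have "1 + R j = (V j + 1) * exp (R j)" for j
  proof -
    have "exp (- R j) * exp (R j) = 1" by (simp add: exp_minus_inverse mult.commute)
    then show ?thesis by (simp add: V_def mult.assoc)
  qed
  then have "(\<Prod>j\<in>N. 1 + R j) = (\<Prod>j\<in>N. V j + 1) * exp (\<Sum>j\<in>N. R j)"
    by (simp add: prod.distrib exp_sum)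
  also have "(\<Prod>j\<in>N. V j + 1) = (\<Sum>J\<in>Pow N. prod V J)"
    by (simp add: prod_add)
  also have "\<dots> = (\<Sum>k\<le>card N. \<Sum>J | J \<in> Pow N \<and> card J = k. prod V J)"
    by (rule sum.group[symmetric]) (auto intro: card_mono)
  finally show ?thesis by (simp add: H_def sum_distrib_right)
qed

theorem norm_prod_minus_expansion:
  assumes \<alpha>: "2 * sqrt 2 * \<alpha> < 1" and l: "l \<le> card N"
  shows "norm ((\<Prod>j\<in>N. 1 + R j) - (\<Sum>k\<le>l. H k)) \<le>
    sqrt (fact (2 * (l + 1))) / fact (l + 1) * sqrt 2 ^ (l + 1) * (\<alpha> ^ (l + 1) / (1 - 2 * sqrt 2 * \<alpha>))"
proof -
  define B where "B k = sqrt (fact (2 * k)) / fact k * sqrt 2 ^ k" for k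
  define t where "t = 2 * sqrt 2 * \<alpha>"
  have t: "0 \<le> t" "t < 1" using \<alpha> \<alpha>_nonneg by (auto simp: t_def)
  \<comment> \<open>\<open>central_ratio\<close> iterated from the first omitted order l + 1: the
    remaining bounds are dominated by a geometric sequence.\<close>
  have growth: "B (Suc l + i) * \<alpha> ^ (Suc l + i) \<le> B (Suc l) * \<alpha> ^ Suc l * t ^ i" for i
  proof (induction i)
    case (Suc i)
    have "B (Suc (Suc l + i)) * \<alpha> ^ Suc (Suc l + i) \<le> (2 * sqrt 2 * B (Suc l + i)) * \<alpha> ^ Suc (Suc l + i)"
      unfolding B_def by (intro mult_right_mono central_ratio zero_le_power \<alpha>_nonneg)
    also have "\<dots> = t * (B (Suc l + i) * \<alpha> ^ (Suc l + i))" by (simp add: t_def)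
    also have "\<dots> \<le> t * (B (Suc l) * \<alpha> ^ Suc l * t ^ i)" using Suc t(1) by (rule mult_left_mono)
    finally show ?case by (simp add: mult_ac)
  qed simp
  have "(\<Prod>j\<in>N. 1 + R j) = (\<Sum>k\<le>l. H k) + (\<Sum>k\<in>{Suc l..card N}. H k)"
    unfolding prod_eq_sum_H using l
    by (subst sum.union_disjoint[symmetric]) (auto intro!: sum.cong)
  then have "norm ((\<Prod>j\<in>N. 1 + R j) - (\<Sum>k\<le>l. H k)) = norm (\<Sum>k\<in>{Suc l..card N}. H k)" by simp
  also have "\<dots> \<le> (\<Sum>k\<in>{Suc l..card N}. B k * \<alpha> ^ k)"
    unfolding B_def by (intro order_trans[OF norm_sum] sum_mono norm_H)
  \<comment> \<open>The range is enlarged by nonnegative terms so that the shifted sum starts at i =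
    0 and is never affected by truncated subtraction, not even for l = card N.\<close>
  also have "\<dots> \<le> (\<Sum>k\<in>{Suc l..Suc l + card N}. B k * \<alpha> ^ k)"
    by (intro sum_mono2) (auto simp: B_def \<alpha>_nonneg)
  also have "\<dots> = (\<Sum>i\<le>card N. B (Suc l + i) * \<alpha> ^ (Suc l + i))"
    by (rule sum.reindex_bij_witness[of _ "\<lambda>i. Suc l + i" "\<lambda>k. k - Suc l"]) auto
  also have "\<dots> \<le> (\<Sum>i\<le>card N. B (Suc l) * \<alpha> ^ Suc l * t ^ i)"
    by (intro sum_mono growth)
  also have "\<dots> = B (Suc l) * \<alpha> ^ Suc l * (\<Sum>i\<le>card N. t ^ i)" by (simp add: sum_distrib_left)
  also have "\<dots> \<le> B (Suc l) * \<alpha> ^ Suc l * (\<Sum>i. t ^ i)"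
    using t \<alpha>_nonneg by (intro mult_left_mono sum_le_suminf summable_geometric) (auto simp: B_def)
  also have "(\<Sum>i. t ^ i) = 1 / (1 - t)" using t by (intro suminf_geometric) simp
  finally show ?thesis by (simp add: B_def t_def)
qed

end

section \<open>Representation of signed measures\<close>

text \<open>\<open>measure_of\<close> gives the null measure unless the set function is countably
  additive. Additivity is inherited from the two finite measures; it will be used with S the Hahn
  set and, with the measures exchanged, its complement.\<close>

lemma emeasure_measure_of_difference:
  assumes fin: "finite_measure \<mu>" "finite_measure \<nu>" and sets: "sets \<mu> = sets M" "sets \<nu> = sets M"
    and S: "S \<in> sets M"
    and G: "\<And>A. A \<in> sets M \<Longrightarrow> G A = measure \<mu> (A \<inter> S) - measure \<nu> (A \<inter> S)"
    and nonneg: "\<And>A. A \<in> sets M \<Longrightarrow> 0 \<le> G A"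
    and A: "A \<in> sets M"
  shows "emeasure (measure_of (space M) (sets M) (\<lambda>A. ennreal (G A))) A = ennreal (G A)"
proof (rule emeasure_measure_of_sigma[OF sets.sigma_algebra_axioms _ _ A])
  interpret \<mu>: finite_measure \<mu> by fact
  interpret \<nu>: finite_measure \<nu> by fact
  show "positive (sets M) (\<lambda>A. ennreal (G A))"
    using G[of "{}"] by (simp add: positive_def)
  show "countably_additive (sets M) (\<lambda>A. ennreal (G A))"
  proof (rule countably_additiveI)
    fix A :: "nat \<Rightarrow> 'a set"
    assume A: "range A \<subseteq> sets M" "disjoint_family A" "\<Union> (range A) \<in> sets M"
    have A': "range (\<lambda>i. A i \<inter> S) \<subseteq> sets M" "disjoint_family (\<lambda>i. A i \<inter> S)"
      using A(1,2) S by (auto simp: disjoint_family_on_def)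
    have "(\<lambda>i. measure \<mu> (A i \<inter> S) - measure \<nu> (A i \<inter> S)) sums
        (measure \<mu> (\<Union>i. A i \<inter> S) - measure \<nu> (\<Union>i. A i \<inter> S))"
      using A' by (intro sums_diff \<mu>.finite_measure_UNION \<nu>.finite_measure_UNION) (auto simp: sets)
    then have "(\<lambda>i. G (A i)) sums G (\<Union> (range A))"
      using A(1,3) G by (simp add: image_subset_iff)
    then show "(\<Sum>i. ennreal (G (A i))) = ennreal (G (\<Union> (range A)))"
      using nonneg A(1) by (intro suminf_ennreal_eq) auto
  qed
qed

text \<open>Stated with sums on both sides, since differences are unreliable in the extended
  nonnegative reals; the standard induction over nonnegative measurable functions then
  applies.\<close>

lemma nn_integral_sum_measure_eq:
  assumes sets: "sets \<mu>1 = sets M" "sets \<mu>2 = sets M" "sets \<nu>1 = sets M" "sets \<nu>2 = sets M"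
    and eq: "\<And>A. A \<in> sets M \<Longrightarrow> emeasure \<mu>1 A + emeasure \<mu>2 A = emeasure \<nu>1 A + emeasure \<nu>2 A"
    and h: "h \<in> borel_measurable M"
  shows "integral\<^sup>N \<mu>1 h + integral\<^sup>N \<mu>2 h = integral\<^sup>N \<nu>1 h + integral\<^sup>N \<nu>2 h"
  using h
proof (induction rule: borel_measurable_induct)
  case (cong f g)
  have "integral\<^sup>N \<kappa> f = integral\<^sup>N \<kappa> g" if "sets \<kappa> = sets M" for \<kappa>
    using cong(3) sets_eq_imp_space_eq[OF that] by (intro nn_integral_cong) simp
  with cong(4) sets show ?case by simp
next
  case (set A)
  then show ?case using eq by (simp add: sets)
next
  case (mult u c)
  have "integral\<^sup>N \<kappa> (\<lambda>x. c * u x) = c * integral\<^sup>N \<kappa> u" if "sets \<kappa> = sets M" for \<kappa>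
    using mult(2) that by (intro nn_integral_cmult) (simp cong: measurable_cong_sets)
  with mult(4) sets show ?case by (simp flip: distrib_left)
next
  case (add u v)
  have "integral\<^sup>N \<kappa> (\<lambda>x. v x + u x) = integral\<^sup>N \<kappa> v + integral\<^sup>N \<kappa> u" if "sets \<kappa> = sets M" for \<kappa>
    using add.hyps that by (intro nn_integral_add) (simp_all cong: measurable_cong_sets)
  then have "integral\<^sup>N \<mu>1 (\<lambda>x. v x + u x) + integral\<^sup>N \<mu>2 (\<lambda>x. v x + u x) =
      (integral\<^sup>N \<mu>1 v + integral\<^sup>N \<mu>2 v) + (integral\<^sup>N \<mu>1 u + integral\<^sup>N \<mu>2 u)"
    and "integral\<^sup>N \<nu>1 (\<lambda>x. v x + u x) + integral\<^sup>N \<nu>2 (\<lambda>x. v x + u x) =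
      (integral\<^sup>N \<nu>1 v + integral\<^sup>N \<nu>2 v) + (integral\<^sup>N \<nu>1 u + integral\<^sup>N \<nu>2 u)"
    using sets by (simp_all add: add_ac)
  with add show ?case by simp
next
  case (seq u)
  have mono: "u m x \<le> u n x" if "m \<le> n" for m n x
    using seq.hyps that by (auto simp: incseq_def le_fun_def)
  have *: "integral\<^sup>N \<kappa> (Sup (range u)) = (SUP i. integral\<^sup>N \<kappa> (u i))" if "sets \<kappa> = sets M" for \<kappa>
  proof -
    have "integral\<^sup>N \<kappa> (\<lambda>x. SUP i. u i x) = (SUP i. integral\<^sup>N \<kappa> (u i))"
      using seq.hyps(1) that
      by (intro nn_integral_monotone_convergence_SUP) (auto simp: incseq_def le_fun_def mono cong: measurable_cong_sets)
    then show ?thesis by (simp add: SUP_apply[abs_def] Sup_fun_def image_comp)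
  qed
  have inc: "incseq (\<lambda>i. integral\<^sup>N \<kappa> (u i))" for \<kappa>
    by (auto simp: incseq_def mono intro!: nn_integral_mono)
  show ?case
    unfolding *[OF sets(1)] *[OF sets(2)] *[OF sets(3)] *[OF sets(4)] ennreal_SUP_add[OF inc inc, symmetric]
    by (simp only: seq.IH)
qed

text \<open>Adding the bound B makes the integrand nonnegative; its contribution is B times the
  total masses, which agree on both sides.\<close>

lemma integral_sum_measure_eq:
  fixes h :: "'a \<Rightarrow> real"
  assumes fin: "finite_measure \<mu>1" "finite_measure \<mu>2" "finite_measure \<nu>1" "finite_measure \<nu>2"
    and sets: "sets \<mu>1 = sets M" "sets \<mu>2 = sets M" "sets \<nu>1 = sets M" "sets \<nu>2 = sets M"
    and eq: "\<And>A. A \<in> sets M \<Longrightarrow> measure \<mu>1 A + measure \<mu>2 A = measure \<nu>1 A + measure \<nu>2 A"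
    and h [measurable]: "h \<in> borel_measurable M" and bound: "\<And>x. \<bar>h x\<bar> \<le> B"
  shows "integral\<^sup>L \<mu>1 h + integral\<^sup>L \<mu>2 h = integral\<^sup>L \<nu>1 h + integral\<^sup>L \<nu>2 h"
proof -
  have B: "0 \<le> B" using bound[of undefined] by linarith
  have main: "ennreal (integral\<^sup>L \<kappa> h + B * measure \<kappa> (space M)) = (\<integral>\<^sup>+x. ennreal (h x + B) \<partial>\<kappa>)"
    "0 \<le> integral\<^sup>L \<kappa> h + B * measure \<kappa> (space M)"
    if "finite_measure \<kappa>" "sets \<kappa> = sets M" for \<kappa>
  proof -
    interpret finite_measure \<kappa> by fact
    have meas: "h \<in> borel_measurable \<kappa>" using h that(2) by (simp cong: measurable_cong_sets)
    have int: "integrable \<kappa> h"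
      using bound by (intro integrable_const_bound[of _ B]) (auto intro: meas)
    have nonneg: "0 \<le> h x + B" for x using bound[of x] by linarith
    have "integral\<^sup>L \<kappa> (\<lambda>x. h x + B) = integral\<^sup>L \<kappa> h + B * measure \<kappa> (space M)"
      using int sets_eq_imp_space_eq[OF that(2)] by simp
    moreover have "(\<integral>\<^sup>+x. ennreal (h x + B) \<partial>\<kappa>) = ennreal (integral\<^sup>L \<kappa> (\<lambda>x. h x + B))"
      using int nonneg by (intro nn_integral_eq_integral) auto
    moreover have "0 \<le> integral\<^sup>L \<kappa> (\<lambda>x. h x + B)" using nonneg by simp
    ultimately show "ennreal (integral\<^sup>L \<kappa> h + B * measure \<kappa> (space M)) = (\<integral>\<^sup>+x. ennreal (h x + B) \<partial>\<kappa>)"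
      "0 \<le> integral\<^sup>L \<kappa> h + B * measure \<kappa> (space M)" by simp_all
  qed
  have em: "emeasure \<mu>1 A + emeasure \<mu>2 A = emeasure \<nu>1 A + emeasure \<nu>2 A" if "A \<in> sets M" for A
    using eq[OF that] fin
    by (simp add: finite_measure.emeasure_eq_measure flip: ennreal_plus)
  have "(\<integral>\<^sup>+x. ennreal (h x + B) \<partial>\<mu>1) + (\<integral>\<^sup>+x. ennreal (h x + B) \<partial>\<mu>2) =
      (\<integral>\<^sup>+x. ennreal (h x + B) \<partial>\<nu>1) + (\<integral>\<^sup>+x. ennreal (h x + B) \<partial>\<nu>2)"
    by (rule nn_integral_sum_measure_eq[OF sets em]) auto
  then have "(integral\<^sup>L \<mu>1 h + B * measure \<mu>1 (space M)) + (integral\<^sup>L \<mu>2 h + B * measure \<mu>2 (space M)) =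
      (integral\<^sup>L \<nu>1 h + B * measure \<nu>1 (space M)) + (integral\<^sup>L \<nu>2 h + B * measure \<nu>2 (space M))"
    unfolding main(1)[OF fin(1) sets(1), symmetric] main(1)[OF fin(2) sets(2), symmetric]
      main(1)[OF fin(3) sets(3), symmetric] main(1)[OF fin(4) sets(4), symmetric]
    using main(2)[OF fin(1) sets(1)] main(2)[OF fin(2) sets(2)] main(2)[OF fin(3) sets(3)] main(2)[OF fin(4) sets(4)]
    by (simp flip: ennreal_plus)
  moreover have "B * (measure \<mu>1 (space M) + measure \<mu>2 (space M)) = B * (measure \<nu>1 (space M) + measure \<nu>2 (space M))"
    using eq[of "space M"] by simp
  ultimately show ?thesis by (simp add: distrib_left)
qed

context
  fixes M \<mu> \<nu> :: "'a measure" and W :: "'a set \<Rightarrow> real"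
  assumes fin: "finite_measure \<mu>" "finite_measure \<nu>" and sets: "sets \<mu> = sets M" "sets \<nu> = sets M"
    and W: "\<And>A. A \<in> sets M \<Longrightarrow> W A = measure \<mu> A - measure \<nu> A"
begin

text \<open>The Hahn decomposition theorem makes the choice operator in the Jordan parts
  meaningful.\<close>

lemma hahn_set_Some: "hahn_set M W (SOME P. hahn_set M W P)"
proof -
  obtain Y where Y: "Y \<in> sets \<mu>" "\<And>X. X \<in> sets \<mu> \<Longrightarrow> X \<subseteq> Y \<Longrightarrow> emeasure \<nu> X \<le> emeasure \<mu> X"
      "\<And>X. X \<in> sets \<mu> \<Longrightarrow> X \<inter> Y = {} \<Longrightarrow> emeasure \<mu> X \<le> emeasure \<nu> X"
    using finite_unsigned_Hahn_decomposition[of \<mu> \<nu>] fin sets by auto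
  then have "hahn_set M W Y"
    using fin W sets unfolding hahn_set_def
    by (auto simp: finite_measure.emeasure_eq_measure)
  then show ?thesis by (rule someI)
qed

lemma jordan_decomposition:
  obtains P where "P \<in> sets M"
    and "\<And>A. A \<in> sets M \<Longrightarrow> 0 \<le> W (A \<inter> P)" "\<And>A. A \<in> sets M \<Longrightarrow> W (A - P) \<le> 0"
    and "\<And>A. A \<in> sets M \<Longrightarrow> emeasure (jordan_pos M W) A = ennreal (W (A \<inter> P))"
    and "\<And>A. A \<in> sets M \<Longrightarrow> emeasure (jordan_neg M W) A = ennreal (- W (A - P))"
proof
  define P where "P = (SOME P. hahn_set M W P)"
  have P: "hahn_set M W P" unfolding P_def by (rule hahn_set_Some)
  show Ps: "P \<in> sets M" using P by (simp add: hahn_set_def)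
  show pos: "0 \<le> W (A \<inter> P)" and neg: "W (A - P) \<le> 0" if "A \<in> sets M" for A
    using P Ps that by (auto simp: hahn_set_def)
  show "emeasure (jordan_pos M W) A = ennreal (W (A \<inter> P))" if "A \<in> sets M" for A
    unfolding jordan_pos_def P_def[symmetric]
    by (rule emeasure_measure_of_difference[OF fin sets Ps]) (use W pos Ps that in auto)
  have diff: "- W (A - P) = measure \<nu> (A \<inter> (space M - P)) - measure \<mu> (A \<inter> (space M - P))"
    if "A \<in> sets M" for A
  proof -
    have "A \<inter> (space M - P) = A - P" using sets.sets_into_space[OF that] by auto
    then show ?thesis using W[of "A - P"] Ps that by simp
  qed
  show "emeasure (jordan_neg M W) A = ennreal (- W (A - P))" if "A \<in> sets M" for A
    unfolding jordan_neg_def P_def[symmetric]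
    by (rule emeasure_measure_of_difference[OF fin(2,1) sets(2,1) _ diff _ that]) (use neg Ps in auto)
qed

lemma sets_jordan: "sets (jordan_pos M W) = sets M" "sets (jordan_neg M W) = sets M"
  by (simp_all add: jordan_pos_def jordan_neg_def)

text \<open>The Jordan parts and the pair \<mu>, \<nu> represent the same set function, so the
  positive part plus \<nu> equals the negative part plus \<mu>. Hence any representation as a
  difference of finite measures may be used to integrate.\<close>

lemma signed_integral_eq:
  assumes "h \<in> borel_measurable M" "\<And>x. \<bar>h x\<bar> \<le> B"
  shows "signed_integral M W h = integral\<^sup>L \<mu> h - integral\<^sup>L \<nu> h"
proof -
  obtain P where P: "P \<in> sets M"
    and sgn: "\<And>A. A \<in> sets M \<Longrightarrow> 0 \<le> W (A \<inter> P)" "\<And>A. A \<in> sets M \<Longrightarrow> W (A - P) \<le> 0"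
    and pos: "\<And>A. A \<in> sets M \<Longrightarrow> emeasure (jordan_pos M W) A = ennreal (W (A \<inter> P))"
    and neg: "\<And>A. A \<in> sets M \<Longrightarrow> emeasure (jordan_neg M W) A = ennreal (- W (A - P))"
    using jordan_decomposition by metis
  interpret \<mu>: finite_measure \<mu> by fact
  interpret \<nu>: finite_measure \<nu> by fact
  have fj: "finite_measure (jordan_pos M W)" "finite_measure (jordan_neg M W)"
    using pos[of "space M"] neg[of "space M"]
    by (auto intro!: finite_measureI simp: sets_eq_imp_space_eq[OF sets_jordan(1)] sets_eq_imp_space_eq[OF sets_jordan(2)])
  have "integral\<^sup>L (jordan_pos M W) h + integral\<^sup>L \<nu> h = integral\<^sup>L (jordan_neg M W) h + integral\<^sup>L \<mu> h"
  proof (rule integral_sum_measure_eq[OF fj(1) fin(2) fj(2) fin(1) sets_jordan(1) sets(2) sets_jordan(2) sets(1) _ assms])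
    fix A assume A: "A \<in> sets M"
    have "measure \<kappa> A = measure \<kappa> (A \<inter> P) + measure \<kappa> (A - P)" if "finite_measure \<kappa>" "sets \<kappa> = sets M" for \<kappa>
      using finite_measure.finite_measure_Union[OF that(1), of "A \<inter> P" "A - P"] A P that(2)
      by (simp add: Int_Diff_disjoint Int_Diff_Un)
    note this[OF fin(1) sets(1)] this[OF fin(2) sets(2)]
    moreover have "A \<inter> P \<in> sets M" "A - P \<in> sets M" using A P by auto
    ultimately have "W A = W (A \<inter> P) + W (A - P)" using A W by simp
    then show "measure (jordan_pos M W) A + measure \<nu> A = measure (jordan_neg M W) A + measure \<mu> A"
      using A sgn pos neg W by (simp add: measure_def)
  qed
  then show ?thesis by (simp add: signed_integral_def)
qed

text \<open>The norm is an evaluation of \<open>W\<close> at a Hahn set and its complement, so it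
  will be bounded by a single pairing.\<close>

lemma tv_norm_eq:
  obtains P where "P \<in> sets M" "tv_norm M W = W P - W (space M - P)"
proof -
  obtain P where P: "P \<in> sets M"
    and sgn: "\<And>A. A \<in> sets M \<Longrightarrow> 0 \<le> W (A \<inter> P)" "\<And>A. A \<in> sets M \<Longrightarrow> W (A - P) \<le> 0"
    and pos: "\<And>A. A \<in> sets M \<Longrightarrow> emeasure (jordan_pos M W) A = ennreal (W (A \<inter> P))"
    and neg: "\<And>A. A \<in> sets M \<Longrightarrow> emeasure (jordan_neg M W) A = ennreal (- W (A - P))"
    using jordan_decomposition by metis
  have "tv_norm M W = W P - W (space M - P)"
    using sgn(1)[of "space M"] sgn(2)[of "space M"] pos[of "space M"] neg[of "space M"] sets.sets_into_space[OF P]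
    by (simp add: tv_norm_def measure_def Int_absorb1)
  with P show ?thesis by (rule that)
qed

end

section \<open>Convolution of probability measures on the semigroup\<close>

locale semigroup_measures =
  fixes M :: "'a::comm_monoid_add measure" and U :: "'i \<Rightarrow> 'a measure"
  assumes semigroup: "measurable_semigroup M"
    and prob_U: "prob_space (U r)" and sets_U: "sets (U r) = sets M"
begin

lemma space_M: "space M = UNIV"
  using semigroup by (simp add: measurable_semigroup_def)

lemma measurable_add [measurable]: "(\<lambda>(x, y). x + y) \<in> measurable (M \<Otimes>\<^sub>M M) M"
  using semigroup by (simp add: measurable_semigroup_def)

definition slice :: "'a \<Rightarrow> 'a set \<Rightarrow> 'a set" where
  "slice x A = {y. x + y \<in> A}"

lemma sum_preimage:
  assumes "A \<in> sets M" "sets \<mu> = sets M" "sets \<nu> = sets M"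
  shows "(\<lambda>(x, y). x + y) -` A \<in> sets (\<mu> \<Otimes>\<^sub>M \<nu>)"
  using measurable_sets[OF measurable_add assms(1)] assms(2,3)
  by (simp add: space_pair_measure space_M cong: sets_pair_measure_cong)

lemma Pair_vimage: "Pair x -` (\<lambda>(x, y). x + y) -` A = slice x A"
  by (auto simp: slice_def)

lemma sets_slice: "A \<in> sets M \<Longrightarrow> slice x A \<in> sets M"
  using sets_Pair1[OF sum_preimage[of A M M], of x] by (simp add: Pair_vimage)

lemma measurable_emeasure_slice:
  assumes "finite_measure \<mu>" "sets \<mu> = sets M" "A \<in> sets M"
  shows "(\<lambda>x. emeasure \<mu> (slice x A)) \<in> borel_measurable M"
proof -
  interpret finite_measure \<mu> by fact
  show ?thesis
    using measurable_emeasure_Pair[OF sum_preimage[OF assms(3) refl assms(2)]] by (simp add: Pair_vimage)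
qed

lemma measurable_measure_slice:
  assumes "finite_measure \<mu>" "sets \<mu> = sets M" "A \<in> sets M"
  shows "(\<lambda>x. measure \<mu> (slice x A)) \<in> borel_measurable M"
  unfolding measure_def using measurable_emeasure_slice[OF assms] by measurable

text \<open>Both iterated integrals are the product measure of the set of pairs with sum in
  A.\<close>

lemma integral_measure_slice_commute:
  assumes "finite_measure \<mu>" "sets \<mu> = sets M" "finite_measure \<nu>" "sets \<nu> = sets M" and A: "A \<in> sets M"
  shows "(\<integral>x. measure \<mu> (slice x A) \<partial>\<nu>) = (\<integral>y. measure \<nu> (slice y A) \<partial>\<mu>)"
proof -
  interpret \<mu>: finite_measure \<mu> by fact
  interpret \<nu>: finite_measure \<nu> by fact
  interpret pair_sigma_finite \<nu> \<mu> by standard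
  have *: "(\<integral>x. measure \<mu>' (slice x A) \<partial>\<nu>') = enn2real (\<integral>\<^sup>+x. emeasure \<mu>' (slice x A) \<partial>\<nu>')"
    if "finite_measure \<mu>'" "sets \<mu>' = sets M" "sets \<nu>' = sets M" for \<mu>' \<nu>'
  proof -
    interpret finite_measure \<mu>' by fact
    show ?thesis
      using measurable_measure_slice[OF that(1,2) A] that(3)
      by (subst integral_eq_nn_integral) (auto simp: emeasure_eq_measure cong: measurable_cong_sets)
  qed
  have pre: "(\<lambda>(x, y). x + y) -` A \<in> sets (\<nu> \<Otimes>\<^sub>M \<mu>)" by (rule sum_preimage[OF A assms(4,2)])
  have "(\<integral>\<^sup>+x. emeasure \<mu> (slice x A) \<partial>\<nu>) = emeasure (\<nu> \<Otimes>\<^sub>M \<mu>) ((\<lambda>(x, y). x + y) -` A)"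
    by (subst \<mu>.emeasure_pair_measure_alt[OF pre]) (simp add: Pair_vimage)
  also have "\<dots> = (\<integral>\<^sup>+y. emeasure \<nu> (slice y A) \<partial>\<mu>)"
  proof -
    have "(\<lambda>x. (x, y)) -` (\<lambda>(x, y). x + y) -` A = slice y A" for y
      by (auto simp: slice_def add.commute)
    then show ?thesis by (subst emeasure_pair_measure_alt2[OF pre]) simp
  qed
  finally show ?thesis using * assms by simp
qed

definition is_prob :: "'a measure \<Rightarrow> bool" where
  "is_prob P \<longleftrightarrow> prob_space P \<and> sets P = sets M"

lemma is_probD: "is_prob P \<Longrightarrow> prob_space P" "is_prob P \<Longrightarrow> sets P = sets M"
  by (simp_all add: is_prob_def)

text \<open>Convolution as a genuine measure, so that associativity and commutativity are equalities
  of measures. The connection with \<open>conv\<close> on set functions is made through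
  \<open>measure_mpower_plus\<close>.\<close>

definition mconv :: "'a measure \<Rightarrow> 'a measure \<Rightarrow> 'a measure" where
  "mconv P Q = distr (P \<Otimes>\<^sub>M Q) M (\<lambda>(x, y). x + y)"

lemma measurable_add': "sets P = sets M \<Longrightarrow> sets Q = sets M \<Longrightarrow> (\<lambda>(x, y). x + y) \<in> measurable (P \<Otimes>\<^sub>M Q) M"
  using measurable_add by (simp cong: measurable_cong_sets sets_pair_measure_cong)

lemma is_prob_mconv:
  assumes "is_prob P" "is_prob Q"
  shows "is_prob (mconv P Q)"
proof -
  interpret P: prob_space P using assms by (simp add: is_prob_def)
  interpret Q: prob_space Q using assms by (simp add: is_prob_def)
  interpret PQ: pair_prob_space P Q by standard
  show ?thesis
    unfolding mconv_def using assms by (simp add: is_prob_def PQ.prob_space_distr measurable_add')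
qed

lemma nn_integral_mconv:
  assumes "is_prob P" "is_prob Q" and f: "f \<in> borel_measurable M"
  shows "integral\<^sup>N (mconv P Q) f = (\<integral>\<^sup>+x. \<integral>\<^sup>+y. f (x + y) \<partial>Q \<partial>P)"
proof -
  interpret P: prob_space P using assms by (simp add: is_prob_def)
  interpret Q: prob_space Q using assms by (simp add: is_prob_def)
  have add: "(\<lambda>(x, y). x + y) \<in> measurable (P \<Otimes>\<^sub>M Q) M"
    using assms by (simp add: is_probD measurable_add')
  have "integral\<^sup>N (mconv P Q) f = (\<integral>\<^sup>+z. f (case z of (x, y) \<Rightarrow> x + y) \<partial>(P \<Otimes>\<^sub>M Q))"
    unfolding mconv_def by (rule nn_integral_distr[OF add]) (simp add: f)
  also have "\<dots> = (\<integral>\<^sup>+x. \<integral>\<^sup>+y. f (case (x, y) of (x, y) \<Rightarrow> x + y) \<partial>Q \<partial>P)"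
    by (rule Q.nn_integral_fst[symmetric]) (use measurable_compose[OF add f] in simp)
  finally show ?thesis by simp
qed

lemma emeasure_mconv:
  assumes "is_prob P" "is_prob Q" "A \<in> sets M"
  shows "emeasure (mconv P Q) A = (\<integral>\<^sup>+x. \<integral>\<^sup>+y. indicator A (x + y) \<partial>Q \<partial>P)"
  using nn_integral_mconv[OF assms(1,2), of "indicator A"] is_probD(2)[OF is_prob_mconv[OF assms(1,2)]] assms(3) by simp

lemma measurable_nn_integral_translate:
  assumes "is_prob Q" "f \<in> borel_measurable M"
  shows "(\<lambda>x. \<integral>\<^sup>+y. f (x + y) \<partial>Q) \<in> borel_measurable M"
proof -
  interpret Q: prob_space Q using assms by (simp add: is_prob_def)
  have "(\<lambda>(x, y). f (x + y)) \<in> borel_measurable (M \<Otimes>\<^sub>M Q)"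
    using measurable_compose[OF measurable_add'[OF refl, of Q] assms(2)] is_probD(2)[OF assms(1)]
    by (simp add: case_prod_unfold)
  then show ?thesis by (rule Q.borel_measurable_nn_integral)
qed

lemma mconv_assoc:
  assumes "is_prob P" "is_prob Q" "is_prob N"
  shows "mconv (mconv P Q) N = mconv P (mconv Q N)"
proof (rule measure_eqI)
  fix A assume "A \<in> sets (mconv (mconv P Q) N)"
  then have A: "A \<in> sets M" by (simp add: mconv_def)
  have tr: "(\<lambda>y. indicator A (x + y) :: ennreal) \<in> borel_measurable M" for x
    using measurable_compose[OF measurable_Pair1'[of x M M] measurable_compose[OF measurable_add borel_measurable_indicator[OF A]]]
    by (simp add: space_M)
  have "emeasure (mconv (mconv P Q) N) A = (\<integral>\<^sup>+z. \<integral>\<^sup>+w. indicator A (z + w) \<partial>N \<partial>mconv P Q)"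
    by (rule emeasure_mconv[OF is_prob_mconv _ A]) (use assms in auto)
  also have "\<dots> = (\<integral>\<^sup>+x. \<integral>\<^sup>+y. \<integral>\<^sup>+w. indicator A (x + y + w) \<partial>N \<partial>Q \<partial>P)"
    by (rule nn_integral_mconv[OF assms(1,2)]) (rule measurable_nn_integral_translate[OF assms(3) borel_measurable_indicator[OF A]])
  also have "\<dots> = (\<integral>\<^sup>+x. \<integral>\<^sup>+z. indicator A (x + z) \<partial>mconv Q N \<partial>P)"
    by (subst nn_integral_mconv[OF assms(2,3) tr]) (simp add: add.assoc)
  also have "\<dots> = emeasure (mconv P (mconv Q N)) A"
    by (rule emeasure_mconv[symmetric, OF _ is_prob_mconv A]) (use assms in auto)
  finally show "emeasure (mconv (mconv P Q) N) A = emeasure (mconv P (mconv Q N)) A" .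
qed (simp add: mconv_def)

lemma mconv_commute:
  assumes "is_prob P" "is_prob Q"
  shows "mconv P Q = mconv Q P"
proof (rule measure_eqI)
  fix A assume "A \<in> sets (mconv P Q)"
  then have A: "A \<in> sets M" by (simp add: mconv_def)
  interpret P: prob_space P using assms by (simp add: is_prob_def)
  interpret Q: prob_space Q using assms by (simp add: is_prob_def)
  interpret pair_sigma_finite P Q by standard
  have "(\<lambda>(x, y). indicator A (x + y) :: ennreal) \<in> borel_measurable (P \<Otimes>\<^sub>M Q)"
    using measurable_compose[OF measurable_add'[of P Q] borel_measurable_indicator[OF A]] assms[THEN is_probD(2)]
    by (simp add: case_prod_unfold)
  then have "(\<integral>\<^sup>+x. \<integral>\<^sup>+y. indicator A (x + y) \<partial>Q \<partial>P) = (\<integral>\<^sup>+y. \<integral>\<^sup>+x. indicator A (x + y) \<partial>P \<partial>Q)"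
    using Fubini[of "\<lambda>(x, y). indicator A (x + y)"] by simp
  then show "emeasure (mconv P Q) A = emeasure (mconv Q P) A"
    using assms A by (simp add: emeasure_mconv add.commute)
qed (simp add: mconv_def)

lemma is_prob_return: "is_prob (return M x)"
  by (simp add: is_prob_def prob_space_return space_M)

lemma mconv_return:
  assumes P: "is_prob P"
  shows "mconv (return M 0) P = P"
proof (rule measure_eqI)
  fix A assume "A \<in> sets (mconv (return M 0) P)"
  then have A: "A \<in> sets M" by (simp add: mconv_def)
  have "emeasure (mconv (return M 0) P) A = (\<integral>\<^sup>+x. \<integral>\<^sup>+y. indicator A (x + y) \<partial>P \<partial>return M 0)"
    by (rule emeasure_mconv[OF is_prob_return P A])
  also have "\<dots> = (\<integral>\<^sup>+y. indicator A (0 + y) \<partial>P)"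
    by (rule nn_integral_return[OF _ measurable_nn_integral_translate[OF P borel_measurable_indicator[OF A]]])
       (simp add: space_M)
  finally show "emeasure (mconv (return M 0) P) A = emeasure P A" using is_probD(2)[OF P] A by simp
qed (simp add: mconv_def is_probD(2)[OF P])

text \<open>
  The case distinction makes the step function commute for arbitrary measures, as
  \<^const>\<open>fold_mset\<close> requires.
\<close>

definition conv_step :: "'i \<Rightarrow> 'a measure \<Rightarrow> 'a measure" where
  "conv_step r P = (if is_prob P then mconv (U r) P else P)"

definition mpower :: "'i multiset \<Rightarrow> 'a measure" where
  "mpower k = fold_mset conv_step (return M 0) k"

lemma is_prob_U: "is_prob (U r)"
  by (simp add: is_prob_def prob_U sets_U)

sublocale conv_step: comp_fun_commute conv_step
proof
  fix r s
  have "conv_step r (conv_step s P) = conv_step s (conv_step r P)" for P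
    using mconv_assoc[of "U r" "U s" P] mconv_assoc[of "U s" "U r" P] mconv_commute[of "U r" "U s"]
      is_prob_mconv[of "U r" P] is_prob_mconv[of "U s" P] is_prob_U
    by (simp add: conv_step_def)
  then show "conv_step s \<circ> conv_step r = conv_step r \<circ> conv_step s" by auto
qed

lemma is_prob_mpower: "is_prob (mpower k)"
proof (induction k)
  case (add r k)
  then show ?case
    using is_prob_mconv[OF is_prob_U, of "mpower k" r] by (simp add: mpower_def conv_step_def)
qed (simp add: mpower_def is_prob_return)

lemma mpower_empty: "mpower {#} = return M 0"
  by (simp add: mpower_def)

lemma mpower_add_mset: "mpower (add_mset r k) = mconv (U r) (mpower k)"
  using is_prob_mpower[of k] by (simp add: mpower_def conv_step_def)

lemma mpower_single: "mpower {#r#} = U r"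
  by (simp add: mpower_add_mset mpower_empty mconv_commute[OF is_prob_U is_prob_return] mconv_return is_prob_U)

text \<open>The homomorphism property on the free commutative monoid; it becomes multiplicativity of
  the map from the algebra in \<open>rep_conv\<close>.\<close>

lemma mpower_plus: "mpower (k + l) = mconv (mpower k) (mpower l)"
proof (induction k)
  case (add r k)
  then show ?case
    by (simp add: mpower_add_mset mconv_assoc is_prob_U is_prob_mpower)
qed (simp add: mpower_empty mconv_return is_prob_mpower)

lemma finite_mpower: "finite_measure (mpower k)" and sets_mpower: "sets (mpower k) = sets M"
  using is_prob_mpower[of k] by (auto simp: is_prob_def prob_space_def)

lemma measure_mpower_le: "measure (mpower k) A \<le> 1"
  by (rule prob_space.prob_le_1[OF is_probD(1)[OF is_prob_mpower]])

lemma measure_mpower_plus: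
  assumes A: "A \<in> sets M"
  shows "(\<integral>x. measure (mpower l) (slice x A) \<partial>mpower k) = measure (mpower (k + l)) A"
proof -
  interpret l: finite_measure "mpower l" by (rule finite_mpower)
  have "emeasure (mpower (k + l)) A = (\<integral>\<^sup>+x. emeasure (mpower l) (slice x A) \<partial>mpower k)"
  proof -
    have "(\<integral>\<^sup>+y. indicator A (x + y) \<partial>mpower l) = emeasure (mpower l) (slice x A)" for x
    proof -
      have "(\<integral>\<^sup>+y. indicator A (x + y) \<partial>mpower l) = (\<integral>\<^sup>+y. indicator (slice x A) y \<partial>mpower l)"
        by (intro nn_integral_cong) (simp add: slice_def indicator_def)
      then show ?thesis using sets_slice[OF A] by (simp add: sets_mpower)
    qed
    then show ?thesis
      by (simp add: mpower_plus emeasure_mconv[OF is_prob_mpower is_prob_mpower A])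
  qed
  moreover have "(\<integral>x. measure (mpower l) (slice x A) \<partial>mpower k) = enn2real (\<integral>\<^sup>+x. emeasure (mpower l) (slice x A) \<partial>mpower k)"
    using measurable_measure_slice[OF finite_mpower sets_mpower A]
    by (subst integral_eq_nn_integral) (auto simp: l.emeasure_eq_measure sets_mpower cong: measurable_cong_sets)
  ultimately show ?thesis by (simp add: measure_def)
qed

lemma abs_integral_mpower_le:
  fixes h :: "'a \<Rightarrow> real"
  assumes h: "h \<in> borel_measurable M" and bound: "\<And>x. \<bar>h x\<bar> \<le> B"
  shows "\<bar>integral\<^sup>L (mpower k) h\<bar> \<le> B"
proof -
  interpret prob_space "mpower k" using is_prob_mpower by (rule is_probD)
  have "h \<in> borel_measurable (mpower k)" using h sets_mpower[of k] by (simp cong: measurable_cong_sets)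
  then have int: "integrable (mpower k) h" using bound by (intro integrable_const_bound[of _ B]) auto
  have "\<bar>integral\<^sup>L (mpower k) h\<bar> \<le> (\<integral>x. \<bar>h x\<bar> \<partial>mpower k)" by (rule integral_abs_bound)
  also have "\<dots> \<le> (\<integral>x. B \<partial>mpower k)" using int bound by (intro integral_mono) auto
  also have "\<dots> = B" by (simp add: prob_space)
  finally show ?thesis .
qed

section \<open>Mixtures of convolution powers\<close>

text \<open>The sum of f k times \<open>mpower k\<close>, obtained as a Markov kernel applied to the
  discrete measure with weights f, so that countable additivity comes for free.\<close>

definition mixture :: "('i multiset \<Rightarrow> real) \<Rightarrow> 'a measure" where
  "mixture f = density (count_space UNIV) (\<lambda>k. ennreal (f k)) \<bind> mpower"

context
  fixes f :: "'i multiset \<Rightarrow> real"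
  assumes f: "f summable_on UNIV" and f_nonneg: "\<And>k. 0 \<le> f k"
begin

lemma integral_density_count_space:
  assumes h: "\<And>k. \<bar>h k\<bar> \<le> (B :: real)"
  shows "(\<integral>k. h k \<partial>density (count_space UNIV) (\<lambda>k. ennreal (f k))) = (\<Sum>\<^sub>\<infinity>k. f k * h k)"
proof -
  have "(\<lambda>k. f k * h k) summable_on UNIV"
    by (rule summable_on_real_bound[OF summable_on_cmult_left[OF f, of B]])
       (simp add: abs_mult f_nonneg mult_left_mono h)
  then have "(\<lambda>k. \<bar>f k * h k\<bar>) summable_on UNIV" by (rule summable_on_abs)
  then have "integrable (count_space UNIV) (\<lambda>k. f k * h k)"
    using abs_summable_equivalent[of "\<lambda>k. f k * h k" UNIV]
    by (simp add: Infinite_Set_Sum.abs_summable_on_def)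
  then have "(\<integral>k. f k * h k \<partial>count_space UNIV) = (\<Sum>\<^sub>\<infinity>k. f k * h k)"
    using infsetsum_infsum[of "\<lambda>k. f k * h k" UNIV]
    by (simp add: Infinite_Set_Sum.abs_summable_on_def infsetsum_def)
  then show ?thesis
    by (subst integral_density) (auto simp: f_nonneg)
qed

lemma finite_density: "finite_measure (density (count_space UNIV) (\<lambda>k. ennreal (f k)))"
proof (rule finite_measureI)
  have "integrable (count_space UNIV) f"
    using abs_summable_equivalent[of f UNIV] summable_on_abs[OF f]
    by (simp add: Infinite_Set_Sum.abs_summable_on_def)
  then have "(\<integral>\<^sup>+k. ennreal (f k) \<partial>count_space UNIV) \<noteq> \<infinity>"
    using f_nonneg by (subst nn_integral_eq_integral) auto
  also have "(\<integral>\<^sup>+k. ennreal (f k) \<partial>count_space UNIV) = emeasure (density (count_space UNIV) (\<lambda>k. ennreal (f k))) UNIV"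
    by (subst emeasure_density) auto
  finally show "emeasure (density (count_space UNIV) (\<lambda>k. ennreal (f k))) (space (density (count_space UNIV) (\<lambda>k. ennreal (f k)))) \<noteq> \<infinity>"
    by (simp only: space_density space_count_space not_False_eq_True)
qed

lemma measurable_mpower: "mpower \<in> measurable (density (count_space UNIV) (\<lambda>k. ennreal (f k))) (subprob_algebra M)"
  using is_probD[OF is_prob_mpower] prob_space_imp_subprob_space
  by (auto simp: space_subprob_algebra)

lemma sets_mixture: "sets (mixture f) = sets M"
  unfolding mixture_def by (rule sets_bind) (auto simp: sets_mpower)

lemma finite_mixture: "finite_measure (mixture f)"
proof (rule finite_measureI)
  interpret finite_measure "density (count_space UNIV) (\<lambda>k. ennreal (f k))" by (rule finite_density)
  have "emeasure (mixture f) (space M) = (\<integral>\<^sup>+k. emeasure (mpower k) (space M) \<partial>density (count_space UNIV) (\<lambda>k. ennreal (f k)))"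
    unfolding mixture_def by (rule emeasure_bind[OF _ measurable_mpower]) auto
  also have "\<dots> \<le> (\<integral>\<^sup>+k. 1 \<partial>density (count_space UNIV) (\<lambda>k. ennreal (f k)))"
  proof (rule nn_integral_mono)
    fix k show "emeasure (mpower k) (space M) \<le> 1"
      by (intro subprob_space.subprob_emeasure_le_1 prob_space_imp_subprob_space is_probD is_prob_mpower)
  qed
  also have "\<dots> = emeasure (density (count_space UNIV) (\<lambda>k. ennreal (f k))) UNIV" by simp
  also have "\<dots> < \<infinity>" using emeasure_finite[of UNIV] unfolding infinity_ennreal_def top.not_eq_extremum .
  finally show "emeasure (mixture f) (space (mixture f)) \<noteq> \<infinity>"
    by (simp add: sets_eq_imp_space_eq[OF sets_mixture])
qed

lemma integral_mixture:
  assumes h: "h \<in> borel_measurable M" and bound: "\<And>x. \<bar>h x\<bar> \<le> B"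
  shows "integral\<^sup>L (mixture f) h = (\<Sum>\<^sub>\<infinity>k. f k * integral\<^sup>L (mpower k) h)"
proof -
  have "integral\<^sup>L (mixture f) h = (\<integral>k. integral\<^sup>L (mpower k) h \<partial>density (count_space UNIV) (\<lambda>k. ennreal (f k)))"
    unfolding mixture_def
  proof (rule integral_bind[OF h bound measurable_mpower finite_density, where B'=1])
    have "emeasure (mpower k) (space (mpower k)) \<le> 1" for k
      using prob_space.emeasure_space_1[OF is_probD(1)[OF is_prob_mpower]] by simp
    then show "AE k in density (count_space UNIV) (\<lambda>k. ennreal (f k)). emeasure (mpower k) (space (mpower k)) \<le> ennreal 1"
      by simp
  qed
  also have "\<dots> = (\<Sum>\<^sub>\<infinity>k. f k * integral\<^sup>L (mpower k) h)"
    by (rule integral_density_count_space[of _ B]) (rule abs_integral_mpower_le[OF h bound])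
  finally show ?thesis .
qed

end

section \<open>Representation of signed measures in the algebra\<close>

text \<open>A relation rather than a map: set functions matter only on \<open>sets M\<close>, and an
  algebra element is not determined by its image, as the \<open>U r\<close> may satisfy relations
  among each other.\<close>

definition rep :: "('a set \<Rightarrow> real) \<Rightarrow> 'i multiset l1 \<Rightarrow> bool" where
  "rep V a \<longleftrightarrow> (\<forall>A\<in>sets M. V A = pairing a (\<lambda>k. measure (mpower k) A))"

lemma repI: "(\<And>A. A \<in> sets M \<Longrightarrow> V A = pairing a (\<lambda>k. measure (mpower k) A)) \<Longrightarrow> rep V a"
  and repD: "rep V a \<Longrightarrow> A \<in> sets M \<Longrightarrow> V A = pairing a (\<lambda>k. measure (mpower k) A)"
  by (simp_all add: rep_def)

lemma abs_measure_mpower_le: "\<bar>measure (mpower k) A\<bar> \<le> 1"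
  by (simp add: measure_mpower_le)

text \<open>Together with \<open>negative_part\<close> this splits by the sign of the coefficients.
  The two measures need not be mutually singular; they only exhibit the image as a difference of
  finite measures.\<close>

definition positive_part :: "'i multiset l1 \<Rightarrow> 'a measure" where
  "positive_part a = mixture (\<lambda>k. max 0 (coeff a k))"

definition negative_part :: "'i multiset l1 \<Rightarrow> 'a measure" where
  "negative_part a = mixture (\<lambda>k. max 0 (- coeff a k))"

lemma max_coeff_summable: "(\<lambda>k. max 0 (coeff a k)) summable_on UNIV" "(\<lambda>k. max 0 (- coeff a k)) summable_on UNIV"
  by (rule summable_on_real_bound[OF abs_coeff_summable[of a]], simp)+

lemma finite_parts: "finite_measure (positive_part a)" "finite_measure (negative_part a)"
  unfolding positive_part_def negative_part_def
  by (intro finite_mixture max_coeff_summable, simp)+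

lemma sets_parts: "sets (positive_part a) = sets M" "sets (negative_part a) = sets M"
  unfolding positive_part_def negative_part_def
  by (intro sets_mixture max_coeff_summable, simp)+

lemma integral_parts:
  fixes h :: "'a \<Rightarrow> real"
  assumes h: "h \<in> borel_measurable M" "\<And>x. \<bar>h x\<bar> \<le> B"
  shows "integral\<^sup>L (positive_part a) h - integral\<^sup>L (negative_part a) h = pairing a (\<lambda>k. integral\<^sup>L (mpower k) h)"
proof -
  have s: "(\<lambda>k. g k * integral\<^sup>L (mpower k) h) summable_on UNIV"
    if "g summable_on UNIV" "\<And>k. 0 \<le> g k" for g
    by (rule summable_on_real_bound[OF summable_on_cmult_left[OF that(1), of B]])
       (simp add: abs_mult that(2) mult_left_mono abs_integral_mpower_le[OF h])
  have "integral\<^sup>L (positive_part a) h - integral\<^sup>L (negative_part a) h =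
      (\<Sum>\<^sub>\<infinity>k. max 0 (coeff a k) * integral\<^sup>L (mpower k) h) + - (\<Sum>\<^sub>\<infinity>k. max 0 (- coeff a k) * integral\<^sup>L (mpower k) h)"
    unfolding positive_part_def negative_part_def
    by (simp add: integral_mixture[OF max_coeff_summable(1) _ h] integral_mixture[OF max_coeff_summable(2) _ h])
  also have "\<dots> = (\<Sum>\<^sub>\<infinity>k. max 0 (coeff a k) * integral\<^sup>L (mpower k) h + - (max 0 (- coeff a k) * integral\<^sup>L (mpower k) h))"
    unfolding infsum_uminus[symmetric]
    by (rule infsum_add[symmetric]) (auto simp: summable_on_uminus intro!: s max_coeff_summable)
  also have "\<dots> = pairing a (\<lambda>k. integral\<^sup>L (mpower k) h)"
    unfolding pairing_def by (rule infsum_cong) (simp add: max_def)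
  finally show ?thesis .
qed

lemma measure_parts:
  assumes "A \<in> sets M"
  shows "pairing a (\<lambda>k. measure (mpower k) A) = measure (positive_part a) A - measure (negative_part a) A"
proof -
  have *: "measure \<kappa> (A \<inter> space \<kappa>) = measure \<kappa> A" if "sets \<kappa> = sets M" for \<kappa>
    using sets.sets_into_space[OF assms] sets_eq_imp_space_eq[OF that] by (simp add: Int_absorb2)
  show ?thesis
    using integral_parts[OF borel_measurable_indicator[OF assms], of 1 a]
    by (simp add: * sets_parts sets_mpower)
qed

lemma rep_signed:
  assumes "rep V a" "A \<in> sets M"
  shows "V A = measure (positive_part a) A - measure (negative_part a) A"
  using repD[OF assms] measure_parts[OF assms(2)] by simp

lemma signed_integral_rep:
  assumes V: "rep V a" and h: "h \<in> borel_measurable M" "\<And>x. \<bar>h x\<bar> \<le> B"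
  shows "signed_integral M V h = pairing a (\<lambda>k. integral\<^sup>L (mpower k) h)"
  using signed_integral_eq[OF finite_parts sets_parts rep_signed[OF V] h] integral_parts[OF h] by simp

text \<open>Evaluating at the Hahn set minus its complement is pairing with a function of absolute
  value at most 1, since both measures of a power lie in [0, 1].\<close>

lemma tv_norm_rep_le:
  assumes V: "rep V a"
  shows "tv_norm M V \<le> norm a"
proof -
  obtain P where P: "P \<in> sets M" and eq: "tv_norm M V = V P - V (space M - P)"
    using tv_norm_eq[OF finite_parts sets_parts rep_signed[OF V]] by metis
  let ?\<phi> = "\<lambda>A k. measure (mpower k) A"
  have "tv_norm M V = pairing a (?\<phi> P) - pairing a (?\<phi> (space M - P))"
    unfolding eq using V P by (simp add: repD)
  also have "\<dots> = (\<Sum>\<^sub>\<infinity>k. coeff a k * ?\<phi> P k) + (\<Sum>\<^sub>\<infinity>k. - (coeff a k * ?\<phi> (space M - P) k))"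
    unfolding pairing_def infsum_uminus by simp
  also have "\<dots> = (\<Sum>\<^sub>\<infinity>k. coeff a k * ?\<phi> P k + - (coeff a k * ?\<phi> (space M - P) k))"
    by (rule infsum_add[symmetric])
       (simp_all only: summable_on_uminus pairing_summable[OF abs_measure_mpower_le])
  also have "\<dots> = pairing a (\<lambda>k. ?\<phi> P k - ?\<phi> (space M - P) k)"
    unfolding pairing_def by (rule infsum_cong) (simp add: right_diff_distrib)
  also have "\<dots> \<le> norm a * 1"
  proof (rule order_trans[OF abs_ge_self pairing_abs_le])
    fix k
    have "0 \<le> ?\<phi> P k" "?\<phi> P k \<le> 1" "0 \<le> ?\<phi> (space M - P) k" "?\<phi> (space M - P) k \<le> 1"
      by (simp_all add: measure_mpower_le)
    then show "\<bar>?\<phi> P k - ?\<phi> (space M - P) k\<bar> \<le> 1" by linarith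
  qed
  finally show ?thesis by simp
qed

lemma rep_dirac: "rep (dirac M 0) 1"
  by (rule repI) (simp add: one_l1_def pairing_single_left dirac_def mpower_empty)

lemma rep_U: "rep (measure (U r)) (gen r)"
  by (rule repI) (simp add: pairing_single_left mpower_single)

lemma pairing_mpower_linear:
  "pairing (a + b) (\<lambda>k. measure (mpower k) A) = pairing a (\<lambda>k. measure (mpower k) A) + pairing b (\<lambda>k. measure (mpower k) A)"
  "pairing (a - b) (\<lambda>k. measure (mpower k) A) = pairing a (\<lambda>k. measure (mpower k) A) - pairing b (\<lambda>k. measure (mpower k) A)"
  "pairing (- a) (\<lambda>k. measure (mpower k) A) = - pairing a (\<lambda>k. measure (mpower k) A)"
  "pairing (c *\<^sub>R a) (\<lambda>k. measure (mpower k) A) = c * pairing a (\<lambda>k. measure (mpower k) A)"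
  "pairing (\<Sum>i\<in>I. f i) (\<lambda>k. measure (mpower k) A) = (\<Sum>i\<in>I. pairing (f i) (\<lambda>k. measure (mpower k) A))"
proof -
  interpret bounded_linear "\<lambda>a. pairing a (\<lambda>k. measure (mpower k) A)"
    by (rule bounded_linear_pairing[OF abs_measure_mpower_le])
  show "pairing (a + b) (\<lambda>k. measure (mpower k) A) = pairing a (\<lambda>k. measure (mpower k) A) + pairing b (\<lambda>k. measure (mpower k) A)"
    "pairing (a - b) (\<lambda>k. measure (mpower k) A) = pairing a (\<lambda>k. measure (mpower k) A) - pairing b (\<lambda>k. measure (mpower k) A)"
    "pairing (- a) (\<lambda>k. measure (mpower k) A) = - pairing a (\<lambda>k. measure (mpower k) A)"
    "pairing (c *\<^sub>R a) (\<lambda>k. measure (mpower k) A) = c * pairing a (\<lambda>k. measure (mpower k) A)"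
    "pairing (\<Sum>i\<in>I. f i) (\<lambda>k. measure (mpower k) A) = (\<Sum>i\<in>I. pairing (f i) (\<lambda>k. measure (mpower k) A))"
    by (simp_all add: add diff neg scaleR sum)
qed

lemma rep_add: "rep V a \<Longrightarrow> rep W b \<Longrightarrow> rep (\<lambda>A. V A + W A) (a + b)"
  and rep_diff: "rep V a \<Longrightarrow> rep W b \<Longrightarrow> rep (\<lambda>A. V A - W A) (a - b)"
  and rep_minus: "rep V a \<Longrightarrow> rep (\<lambda>A. - V A) (- a)"
  and rep_cmult: "rep V a \<Longrightarrow> rep (\<lambda>A. c * V A) (c *\<^sub>R a)"
  by (auto simp: rep_def pairing_mpower_linear)

lemma rep_sum: "(\<And>i. i \<in> I \<Longrightarrow> rep (V i) (f i)) \<Longrightarrow> rep (\<lambda>A. \<Sum>i\<in>I. V i A) (\<Sum>i\<in>I. f i)"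
  by (auto simp: rep_def pairing_mpower_linear intro!: sum.cong)

text \<open>For fixed l the integral over \<open>mpower l\<close> is exchanged with the two measures
  representing V, and the inner integral becomes a measure of \<open>mpower (l + k)\<close>. The
  double pairing that results is the pairing with the product, up to commutativity.\<close>

lemma rep_conv:
  assumes V: "rep V a" and W: "rep W b"
  shows "rep (conv M V W) (a * b)"
proof (rule repI)
  fix A assume A: "A \<in> sets M"
  have V': "V (slice x A) = measure (positive_part a) (slice x A) - measure (negative_part a) (slice x A)" for x
    by (rule rep_signed[OF V sets_slice[OF A]])
  have meas: "(\<lambda>x. V (slice x A)) \<in> borel_measurable M"
    unfolding V' by (intro borel_measurable_diff measurable_measure_slice finite_parts sets_parts A)
  have bound: "\<bar>V (slice x A)\<bar> \<le> norm a" for x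
    using pairing_abs_le[of "\<lambda>k. measure (mpower k) (slice x A)" 1 a, OF abs_measure_mpower_le]
      repD[OF V sets_slice[OF A]] by simp
  have "conv M V W A = signed_integral M W (\<lambda>x. V (slice x A))"
    by (simp add: conv_def slice_def space_M)
  also have "\<dots> = pairing b (\<lambda>l. \<integral>x. V (slice x A) \<partial>mpower l)"
    by (rule signed_integral_rep[OF W meas bound])
  also have "(\<lambda>l. \<integral>x. V (slice x A) \<partial>mpower l) = (\<lambda>l. pairing a (\<lambda>k. measure (mpower (l + k)) A))"
  proof
    fix l
    have int: "integrable (mpower l) (\<lambda>x. measure \<mu> (slice x A))" if \<mu>: "finite_measure \<mu>" "sets \<mu> = sets M" for \<mu>
    proof -
      interpret finite_measure "mpower l" by (rule finite_mpower)
      show ?thesis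
        using measurable_measure_slice[OF \<mu> A] finite_measure.bounded_measure[OF \<mu>(1)] sets_mpower[of l]
        by (intro integrable_const_bound[of _ "measure \<mu> (space \<mu>)"]) (auto cong: measurable_cong_sets)
    qed
    have "(\<integral>x. V (slice x A) \<partial>mpower l) =
        (\<integral>x. measure (positive_part a) (slice x A) \<partial>mpower l) - (\<integral>x. measure (negative_part a) (slice x A) \<partial>mpower l)"
      unfolding V' by (intro Bochner_Integration.integral_diff int finite_parts sets_parts)
    \<comment> \<open>Fubini: the roles of \<open>mpower l\<close> and the parts of \<open>a\<close>
      are exchanged, which makes \<open>integral_parts\<close> applicable.\<close>
    also have "\<dots> = (\<integral>y. measure (mpower l) (slice y A) \<partial>positive_part a) - (\<integral>y. measure (mpower l) (slice y A) \<partial>negative_part a)"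
      by (simp add: integral_measure_slice_commute[OF _ _ finite_mpower sets_mpower A] finite_parts sets_parts)
    also have "\<dots> = pairing a (\<lambda>k. \<integral>y. measure (mpower l) (slice y A) \<partial>mpower k)"
      by (intro integral_parts[where B=1] measurable_measure_slice finite_mpower sets_mpower A abs_measure_mpower_le)
    finally show "(\<integral>x. V (slice x A) \<partial>mpower l) = pairing a (\<lambda>k. measure (mpower (l + k)) A)"
      by (simp add: measure_mpower_plus[OF A] add.commute)
  qed
  also have "pairing b (\<lambda>l. pairing a (\<lambda>k. measure (mpower (l + k)) A)) = pairing (b * a) (\<lambda>k. measure (mpower k) A)"
    by (rule pairing_times[symmetric, OF abs_measure_mpower_le])
  finally show "conv M V W A = pairing (a * b) (\<lambda>k. measure (mpower k) A)" by (simp add: mult.commute)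
qed

lemma rep_conv_power: "rep V a \<Longrightarrow> rep (conv_power M V m) (a ^ m)"
  unfolding conv_power_def by (induction m) (auto intro: rep_dirac rep_conv)

text \<open>The exponential series converges in norm, and evaluation at A is a bounded linear
  functional, so the setwise series of \<open>conv_exp\<close> converges to the right value.\<close>

lemma rep_conv_exp:
  assumes V: "rep V a"
  shows "rep (conv_exp M V) (exp a)"
proof (rule repI)
  fix A assume A: "A \<in> sets M"
  have "(\<lambda>m. pairing (a ^ m /\<^sub>R fact m) (\<lambda>k. measure (mpower k) A)) sums pairing (exp a) (\<lambda>k. measure (mpower k) A)"
    unfolding exp_def
    by (intro bounded_linear.sums[OF bounded_linear_pairing[OF abs_measure_mpower_le]] summable_sums summable_exp_generic)
  moreover have "pairing (a ^ m /\<^sub>R fact m) (\<lambda>k. measure (mpower k) A) = conv_power M V m A / fact m" for m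
    using repD[OF rep_conv_power[OF V] A] by (simp add: pairing_mpower_linear divide_inverse_commute)
  ultimately show "conv_exp M V A = pairing (exp a) (\<lambda>k. measure (mpower k) A)"
    by (simp add: conv_exp_def sums_iff)
qed

lemma rep_conv_prod:
  assumes "finite J" "\<And>j. j \<in> J \<Longrightarrow> rep (V j) (f j)"
  shows "rep (conv_prod M V J) (prod f J)"
proof -
  have "rep (foldr (\<lambda>j. conv M (V j)) js (dirac M 0)) (prod_list (map f js))" if "set js \<subseteq> J" for js
    using that by (induction js) (auto intro: rep_dirac rep_conv assms(2))
  from this[of "sorted_list_of_set J"] show ?thesis
    using assms(1) prod.distinct_set_conv_list[of "sorted_list_of_set J" f] by (simp add: conv_prod_def)
qed

end

section \<open>Transfer of the estimate to the signed measures\<close>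

theorem theorem2p1:
  fixes M :: "'a::comm_monoid_add measure"
    and d n l :: nat
    and p :: "nat \<Rightarrow> real"
    and q :: "nat \<Rightarrow> nat \<Rightarrow> real"
    and U :: "nat \<Rightarrow> 'a measure"
  assumes semigroup: "measurable_semigroup M"
    and d: "d \<ge> 1" and n: "n \<ge> 1" and l: "l \<le> n"
    and p: "\<And>j. j \<in> {1..n} \<Longrightarrow> p j \<in> {0..1}"
    and q: "\<And>j r. j \<in> {1..n} \<Longrightarrow> r \<in> {1..d} \<Longrightarrow> q j r \<in> {0..1}"
    and q_sum: "\<And>j. j \<in> {1..n} \<Longrightarrow> (\<Sum>r=1..d. q j r) = 1"
    and U_prob: "\<And>r. r \<in> {1..d} \<Longrightarrow> prob_space (U r)"
    and U_sets: "\<And>r. r \<in> {1..d} \<Longrightarrow> sets (U r) = sets M"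
  defines "lamr \<equiv> \<lambda>r. \<Sum>j=1..n. p j * q j r"
  assumes lamr_pos: "\<And>r. r \<in> {1..d} \<Longrightarrow> lamr r > 0"
  defines "lam \<equiv> \<Sum>j=1..n. p j"
    and "Qj \<equiv> \<lambda>j A. \<Sum>r=1..d. q j r * measure (U r) A"
  defines "Q \<equiv> \<lambda>A. 1 / lam * (\<Sum>j=1..n. p j * Qj j A)"
    and "R \<equiv> \<lambda>j A. p j * (Qj j A - dirac M 0 A)"
  defines "Fj \<equiv> \<lambda>j A. dirac M 0 A + R j A"
  defines "V \<equiv> \<lambda>j A. conv M (Fj j) (conv_exp M (\<lambda>B. - R j B)) A - dirac M 0 A"
    and "F \<equiv> conv_prod M Fj {1..n}"
  defines "Mk \<equiv> \<lambda>k A. \<Sum>J | J \<subseteq> {1..n} \<and> card J = k. conv_prod M V J A"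
  defines "H \<equiv> \<lambda>k. conv M (Mk k) (conv_exp M (\<lambda>A. lam * (Q A - dirac M 0 A)))"
  defines "G \<equiv> \<lambda>A. \<Sum>k=0..l. H k A"
  defines "\<alpha>\<^sub>1 \<equiv> \<Sum>j=1..n. g_fun (2 * p j) * (p j)\<^sup>2 *
                 (\<Sum>r=1..d. q j r * min (q j r / (2 powr (3/2) * lamr r)) 2)"
  assumes alpha1: "\<alpha>\<^sub>1 < 1 / 2 powr (3/2)"
  shows "tv_norm M (\<lambda>A. F A - G A)
           \<le> sqrt (fact (2 * (l + 1))) / fact (l + 1) * 2 powr (real (l + 1) / 2) *
              (\<alpha>\<^sub>1 ^ (l + 1) / (1 - 2 powr (3/2) * \<alpha>\<^sub>1))"
proof -
  note [simp del] = One_nat_def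
  \<comment> \<open>The general setting asks for a probability measure at every index; outside
    {1..d} the Dirac measure at 0 fills in, and only generators in {1..d} enter the elements
    below.\<close>
  define U' where "U' r = (if r \<in> {1..d} then U r else return M 0)" for r
  have "space M = UNIV" using semigroup by (simp only: measurable_semigroup_def)
  then have prob: "prob_space (U' r)" "sets (U' r) = sets M" for r
    using U_prob[of r] U_sets[of r] prob_space_return[of 0 M] by (cases "r \<in> {1..d}"; simp add: U'_def)+
  interpret semigroup_measures M U'
    by (rule semigroup_measures.intro[OF semigroup prob])
  interpret K: kerstan "{1..n}" "{1..d}" p q
  proof (rule kerstan.intro)
    show "0 \<le> p j" if "j \<in> {1..n}" for j using p[OF that] by simp
    show "0 \<le> q j r" if "j \<in> {1..n}" "r \<in> {1..d}" for j r using q[OF that] by simp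
    show "0 < (\<Sum>j=1..n. p j * q j r)" if "r \<in> {1..d}" for r
      using lamr_pos[OF that] by (simp only: lamr_def)
  qed (simp_all only: q_sum finite_atLeastAtMost)
  have rep_R: "rep (R j) (K.R j)" if j: "j \<in> {1..n}" for j
  proof -
    have "rep (Qj j) (\<Sum>r=1..d. q j r *\<^sub>R gen r)"
      unfolding Qj_def
    proof (intro rep_sum rep_cmult)
      fix r assume "r \<in> {1..d}"
      then show "rep (measure (U r)) (gen r)" using rep_U[of r] by (simp add: U'_def)
    qed
    then show ?thesis
      unfolding R_def K.R_eq[OF j] by (intro rep_cmult rep_diff rep_dirac)
  qed
  have rep_F: "rep (Fj j) (1 + K.R j)" if "j \<in> {1..n}" for j
    unfolding Fj_def by (rule rep_add[OF rep_dirac rep_R[OF that]])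
  have rep_V: "rep (V j) (K.V j)" if "j \<in> {1..n}" for j
    unfolding V_def K.V_def
    by (rule rep_diff[OF rep_conv[OF rep_F[OF that] rep_conv_exp[OF rep_minus[OF rep_R[OF that]]]] rep_dirac])
  \<comment> \<open>\<open>lam\<close> is the sum of the positive \<open>lamr r\<close>, a nonempty
    sum as d is at least 1; positivity lets the factor 1 / lam in \<open>Q\<close> cancel.\<close>
  have "0 < lam"
  proof -
    have "lam = (\<Sum>r=1..d. lamr r)"
      unfolding lam_def lamr_def by (subst sum.swap) (simp only: sum_distrib_left[symmetric] q_sum mult_1_right cong: sum.cong)
    also have "\<dots> > 0" using d by (intro sum_pos lamr_pos) auto
    finally show ?thesis .
  qed
  have rep_lam: "rep (\<lambda>A. lam * (Q A - dirac M 0 A)) (\<Sum>j=1..n. K.R j)"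
  proof -
    have "lam * (Q A - dirac M 0 A) = (\<Sum>j=1..n. R j A)" for A
    proof -
      have "lam * (Q A - dirac M 0 A) = (\<Sum>j=1..n. p j * Qj j A) - lam * dirac M 0 A"
        using \<open>0 < lam\<close> by (simp only: Q_def) (simp add: right_diff_distrib)
      also have "\<dots> = (\<Sum>j=1..n. R j A)"
        by (simp only: lam_def R_def right_diff_distrib sum_subtractf sum_distrib_right)
      finally show ?thesis .
    qed
    then show ?thesis using rep_sum[OF rep_R, of "{1..n}" "\<lambda>j. j"] by (simp only: atLeastAtMost_iff)
  qed
  have rep_H: "rep (H k) (K.H k)" for k
    unfolding H_def K.H_def Mk_def
    by (rule rep_conv[OF rep_sum[OF rep_conv_prod] rep_conv_exp[OF rep_lam]])
       (auto intro: rep_V finite_subset)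
  have rep_FG: "rep (\<lambda>A. F A - G A) ((\<Prod>j=1..n. 1 + K.R j) - (\<Sum>k=0..l. K.H k))"
    unfolding F_def G_def by (rule rep_diff[OF rep_conv_prod[OF _ rep_F] rep_sum[OF rep_H]]) auto
  have sqrt2: "2 powr (3/2) = 2 * sqrt (2::real)"
    using powr_add[of 2 1 "1/2 :: real"] by (simp add: powr_half_sqrt)
  have \<alpha>: "\<alpha>\<^sub>1 = K.\<alpha>"
    by (simp only: \<alpha>\<^sub>1_def K.\<alpha>_def K.rate_def lamr_def sqrt2)
  have "tv_norm M (\<lambda>A. F A - G A) \<le> norm ((\<Prod>j=1..n. 1 + K.R j) - (\<Sum>k\<le>l. K.H k))"
    using tv_norm_rep_le[OF rep_FG] by (simp only: atMost_atLeast0)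
  also have "\<dots> \<le> sqrt (fact (2 * (l + 1))) / fact (l + 1) * sqrt 2 ^ (l + 1) *
      (K.\<alpha> ^ (l + 1) / (1 - 2 * sqrt 2 * K.\<alpha>))"
  proof (rule K.norm_prod_minus_expansion)
    show "2 * sqrt 2 * K.\<alpha> < 1"
      using alpha1 unfolding \<alpha> sqrt2 by (simp add: pos_less_divide_eq mult.commute)
  qed (use l in simp)
  also have "sqrt 2 ^ (l + 1) = (2 :: real) powr (real (l + 1) / 2)"
    by (simp add: powr_half_sqrt[symmetric] powr_powr flip: powr_realpow)
  finally show ?thesis by (simp only: \<alpha> sqrt2)
qed

end
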